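(* Let $n\ge 2$, let $E_{2,n}(x_1,\ldots,x_n)=\sum_{1\le i<j\le n}x_ix_j$, and let $\beta$ be real. The function $E_{2,n}^{-\beta}$ is completely monotone on $(0,\infty)^n$ if and only if $\beta=0$ or $\beta\ge(n-2)/2$.
   Context: A $C^\infty$ function $f$ on $(0,\infty)^n$ is completely monotone if $(-1)^k\,\partial^kf/\partial x_{i_1}\cdots\partial x_{i_k}\ge 0$ everywhere on $(0,\infty)^n$ for all $k\ge 0$ and all indices $i_1,\ldots,i_k$. *)

theory Defs
  imports "HOL-Analysis.Analysis"
begin

definition positive_orthant :: "(real ^ 'n) set" where
  "positive_orthant = {x. \<forall>i. 0 < x $ i}"

definition partial_deriv :: "'n \<Rightarrow> (real ^ 'n \<Rightarrow> real) \<Rightarrow> real ^ 'n \<Rightarrow> real" where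
  "partial_deriv i f x = deriv (\<lambda>t. f (x + t *\<^sub>R axis i 1)) 0"

(* The list [i1, ..., ik] stands for d^k / (dx_i1 ... dx_ik); the last index is applied first. *)
definition iter_partial :: "'n list \<Rightarrow> (real ^ 'n \<Rightarrow> real) \<Rightarrow> real ^ 'n \<Rightarrow> real" where
  "iter_partial is f = foldr partial_deriv is f"

(* C-infinity on an open set S: all iterated partial derivatives exist and are continuous on S.
   Existence is stated separately because deriv is total. Since S is open, the
   values of f outside S are irrelevant. *)
definition C_infinity_on :: "(real ^ 'n) set \<Rightarrow> (real ^ 'n \<Rightarrow> real) \<Rightarrow> bool" where
  "C_infinity_on S f \<longleftrightarrow>
     (\<forall>is. continuous_on S (iter_partial is f) \<and>
       (\<forall>i. \<forall>x\<in>S. (\<lambda>t. iter_partial is f (x + t *\<^sub>R axis i 1)) field_differentiable at 0))"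

definition completely_monotone :: "(real ^ 'n \<Rightarrow> real) \<Rightarrow> bool" where
  "completely_monotone f \<longleftrightarrow>
     C_infinity_on positive_orthant f \<and>
     (\<forall>is. \<forall>x\<in>positive_orthant. (- 1) ^ length is * iter_partial is f x \<ge> 0)"

(* The linear order on the index type serves only to single out each pair i < j once. *)
definition E2 :: "real ^ 'n::{finite, linorder} \<Rightarrow> real" where
  "E2 x = (\<Sum>(i, j)\<in>{(i, j). i < j}. x $ i * x $ j)"

end

theory Submission
  imports Defs "HOL-Probability.Distributions"
begin

text \<open>Complete monotonicity is traded for the sign condition on all iterated finite differences
  (\<open>difference_monotone\<close>), which passes to products, pointwise limits and integrals over a
  parameter without differentiating under the integral sign.

  Sufficiency: \<open>2 E2 = (r \<bullet> x) (p \<bullet> x) - (\<Sum>l\<in>ls. (l \<bullet> x)\<^sup>2)\<close> with \<open>p, r\<close> nonnegative linear forms and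
  \<open>n - 2\<close> squares. A Gamma integral writes \<open>(2 E2)\<^sup>-\<^sup>\<beta>\<close> as a mixture over \<open>s\<close> of
  \<open>(p \<bullet> x)\<^sup>-\<^sup>\<beta> exp (- s (r \<bullet> x) + s (\<Sum>l\<in>ls. (l \<bullet> x)\<^sup>2) / (p \<bullet> x))\<close>. One Gaussian integral per square
  makes the exponent linear in \<open>x\<close>, each using up a factor \<open>(p \<bullet> x)\<^sup>-\<^sup>1\<^sup>/\<^sup>2\<close>, and what is left is a
  power of \<open>p \<bullet> x\<close> with exponent \<open>(n - 2) / 2 - \<beta> \<le> 0\<close>.

  Necessity: if \<open>f\<close> is completely monotone and \<open>P\<close> is a real quadratic form, then \<open>P(\<partial>)\<^sup>2 f \<ge> 0\<close>,
  as it would follow from Bernstein's representation by a positive measure. Cayley's identity for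
  the form dual to \<open>E2\<close> in \<open>m\<close> variables gives \<open>P(\<partial>)\<^sup>2\<close> of \<open>E2\<^sup>-\<^sup>\<beta>\<close> the sign of
  \<open>\<beta> (\<beta> + 1) (2 \<beta> + 2 - m) (2 \<beta> + 4 - m)\<close>, which is negative for \<open>m - 4 < 2 \<beta> < m - 2\<close>. Such an
  \<open>m \<le> n\<close> exists when \<open>0 < \<beta> < (n - 2) / 2\<close>; the other \<open>n - m\<close> variables are sent to \<open>0\<close>.\<close>

section \<open>Difference monotone functions\<close>

text \<open>The sign is opposite to that of the usual forward difference: it absorbs the factor
  \<open>(- 1) ^ k\<close> of complete monotonicity, so that the condition becomes plain
  nonnegativity.\<close>

definition forward_drop :: "'n \<Rightarrow> real \<Rightarrow> (real ^ 'n \<Rightarrow> real) \<Rightarrow> real ^ 'n \<Rightarrow> real" where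
  "forward_drop i h f x = f x - f (x + h *\<^sub>R axis i 1)"

fun iter_drop :: "('n \<times> real) list \<Rightarrow> (real ^ 'n \<Rightarrow> real) \<Rightarrow> real ^ 'n \<Rightarrow> real" where
  "iter_drop [] f = f"
| "iter_drop ((i, h) # ps) f = iter_drop ps (forward_drop i h f)"

definition difference_monotone :: "(real ^ 'n \<Rightarrow> real) \<Rightarrow> bool" where
  "difference_monotone f \<longleftrightarrow>
     (\<forall>ps. \<forall>x\<in>positive_orthant. (\<forall>(i, h)\<in>set ps. 0 \<le> h) \<longrightarrow> 0 \<le> iter_drop ps f x)"

lemma positive_orthant_shift:
  assumes "x \<in> positive_orthant" "0 \<le> h"
  shows "x + h *\<^sub>R axis i 1 \<in> positive_orthant"
  using assms by (auto simp: positive_orthant_def axis_def add_pos_nonneg)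

lemma inner_pos_orthant:
  fixes p x :: "real ^ 'n::finite"
  assumes "\<And>i. 0 \<le> p $ i" "p \<noteq> 0" "x \<in> positive_orthant"
  shows "0 < p \<bullet> x"
proof -
  obtain j where "p $ j \<noteq> 0" using \<open>p \<noteq> 0\<close> by (auto simp: vec_eq_iff)
  with assms have "0 < p $ j * x $ j"
    by (metis (mono_tags, lifting) less_eq_real_def mem_Collect_eq mult_pos_pos positive_orthant_def)
  moreover have "\<And>i. 0 \<le> p $ i * x $ i"
    using assms by (simp add: positive_orthant_def less_imp_le)
  ultimately have "0 < (\<Sum>i\<in>UNIV. p $ i * x $ i)"
    by (intro sum_pos2[of _ j]) auto
  then show ?thesis by (simp add: inner_vec_def)
qed

lemma difference_monotone_nonneg:
  "difference_monotone f \<Longrightarrow> x \<in> positive_orthant \<Longrightarrow> 0 \<le> f x"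
  unfolding difference_monotone_def by (metis empty_iff iter_drop.simps(1) list.set(1))

lemma difference_monotone_forward_drop:
  assumes "difference_monotone f" "0 \<le> h"
  shows "difference_monotone (forward_drop i h f)"
  unfolding difference_monotone_def
proof (intro allI ballI impI)
  fix ps :: "('a \<times> real) list" and x :: "real ^ 'a"
  assume "x \<in> positive_orthant" "\<forall>(i, h)\<in>set ps. 0 \<le> h"
  then have "0 \<le> iter_drop ((i, h) # ps) f x"
    using assms unfolding difference_monotone_def by (metis (no_types, lifting) case_prodI set_ConsD)
  then show "0 \<le> iter_drop ps (forward_drop i h f) x" by simp
qed

text \<open>The difference monotone functions form the largest class whose members are nonnegative
  on the orthant and which is closed under drops with nonnegative steps. Any class \<open>X\<close>
  with these two properties therefore lies inside it.\<close>

lemma difference_monotone_coinduct: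
  assumes "X f"
    and nonneg: "\<And>f x. X f \<Longrightarrow> x \<in> positive_orthant \<Longrightarrow> 0 \<le> f x"
    and step: "\<And>f i h. X f \<Longrightarrow> 0 \<le> h \<Longrightarrow> X (forward_drop i h f)"
  shows "difference_monotone f"
  unfolding difference_monotone_def
proof (intro allI ballI impI)
  fix ps :: "('a \<times> real) list" and x :: "real ^ 'a"
  assume "x \<in> positive_orthant" "\<forall>(i, h)\<in>set ps. 0 \<le> h"
  then show "0 \<le> iter_drop ps f x"
    using \<open>X f\<close> by (induction ps f rule: iter_drop.induct) (auto intro: nonneg step)
qed

text \<open>Nonnegative steps never leave the orthant, so all drops at its points are determined by
  the values there.\<close>

lemma difference_monotone_cong:
  assumes "difference_monotone f" "\<And>x. x \<in> positive_orthant \<Longrightarrow> f x = g x"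
  shows "difference_monotone g"
proof (rule difference_monotone_coinduct[where X = "\<lambda>g. \<exists>f. difference_monotone f \<and> (\<forall>x\<in>positive_orthant. f x = g x)"])
  fix g :: "real ^ 'a \<Rightarrow> real" and i :: 'a and h :: real
  assume "\<exists>f. difference_monotone f \<and> (\<forall>x\<in>positive_orthant. f x = g x)" "0 \<le> h"
  then show "\<exists>f. difference_monotone f \<and> (\<forall>x\<in>positive_orthant. f x = forward_drop i h g x)"
    by (metis difference_monotone_forward_drop forward_drop_def positive_orthant_shift)
next
  fix g :: "real ^ 'a \<Rightarrow> real" and x :: "real ^ 'a"
  assume "\<exists>f. difference_monotone f \<and> (\<forall>x\<in>positive_orthant. f x = g x)" "x \<in> positive_orthant"
  then show "0 \<le> g x" by (metis difference_monotone_nonneg)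
qed (use assms in auto)

section \<open>Closure under sums, shifts, products, limits and integrals\<close>

lemma difference_monotone_add:
  assumes "difference_monotone f" "difference_monotone g"
  shows "difference_monotone (\<lambda>x. f x + g x)"
proof (rule difference_monotone_coinduct[where
      X = "\<lambda>k. \<exists>f g. difference_monotone f \<and> difference_monotone g \<and> k = (\<lambda>x. f x + g x)"])
  fix k :: "real ^ 'a \<Rightarrow> real" and i :: 'a and h :: real
  assume "\<exists>f g. difference_monotone f \<and> difference_monotone g \<and> k = (\<lambda>x. f x + g x)" and h: "0 \<le> h"
  then obtain f g where fg: "difference_monotone f" "difference_monotone g" "k = (\<lambda>x. f x + g x)"
    by blast
  have "forward_drop i h k = (\<lambda>x. forward_drop i h f x + forward_drop i h g x)"
    by (auto simp: forward_drop_def fg)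
  with fg h show "\<exists>f g. difference_monotone f \<and> difference_monotone g \<and> forward_drop i h k = (\<lambda>x. f x + g x)"
    using difference_monotone_forward_drop by blast
next
  fix k :: "real ^ 'a \<Rightarrow> real" and x :: "real ^ 'a"
  assume "\<exists>f g. difference_monotone f \<and> difference_monotone g \<and> k = (\<lambda>x. f x + g x)"
    and x: "x \<in> positive_orthant"
  then show "0 \<le> k x" by (auto dest!: difference_monotone_nonneg[OF _ x])
qed (use assms in blast)

lemma difference_monotone_const: "0 \<le> c \<Longrightarrow> difference_monotone (\<lambda>x. c)"
  by (rule difference_monotone_coinduct[where X = "\<lambda>f. \<exists>c\<ge>0. f = (\<lambda>x. c)"])
    (auto simp: forward_drop_def fun_eq_iff)

lemma difference_monotone_shift:
  assumes "difference_monotone f" "0 \<le> h"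
  shows "difference_monotone (\<lambda>x. f (x + h *\<^sub>R axis i 1))"
proof (rule difference_monotone_coinduct[where
      X = "\<lambda>k. \<exists>f. difference_monotone f \<and> k = (\<lambda>x. f (x + h *\<^sub>R axis i 1))"])
  fix k :: "real ^ 'a \<Rightarrow> real" and j :: 'a and d :: real
  assume "\<exists>f. difference_monotone f \<and> k = (\<lambda>x. f (x + h *\<^sub>R axis i 1))" and d: "0 \<le> d"
  then obtain f where f: "difference_monotone f" "k = (\<lambda>x. f (x + h *\<^sub>R axis i 1))"
    by blast
  have "forward_drop j d k = (\<lambda>x. forward_drop j d f (x + h *\<^sub>R axis i 1))"
    by (auto simp: forward_drop_def f algebra_simps)
  with f d show "\<exists>f. difference_monotone f \<and> forward_drop j d k = (\<lambda>x. f (x + h *\<^sub>R axis i 1))"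
    using difference_monotone_forward_drop by blast
qed (use assms difference_monotone_nonneg positive_orthant_shift in \<open>blast+\<close>)

lemma forward_drop_sum:
  "forward_drop i h (\<lambda>x. \<Sum>a\<in>A. c a * g a x) = (\<lambda>x. \<Sum>a\<in>A. c a * forward_drop i h (g a) x)"
  by (auto simp: forward_drop_def sum_subtractf right_diff_distrib)

lemma iter_drop_sum:
  "iter_drop ps (\<lambda>x. \<Sum>a\<in>A. c a * g a x) x = (\<Sum>a\<in>A. c a * iter_drop ps (g a) x)"
proof (induction ps arbitrary: g)
  case (Cons p ps)
  then show ?case by (cases p) (simp add: forward_drop_sum)
qed simp

lemma difference_monotone_sum:
  assumes "\<And>a. a \<in> A \<Longrightarrow> 0 \<le> c a" "\<And>a. a \<in> A \<Longrightarrow> difference_monotone (g a)"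
  shows "difference_monotone (\<lambda>x. \<Sum>a\<in>A. c a * g a x)"
  using assms unfolding difference_monotone_def iter_drop_sum by (auto intro!: sum_nonneg)

lemma difference_monotone_cmult:
  assumes "0 \<le> c" "difference_monotone f"
  shows "difference_monotone (\<lambda>x. c * f x)"
  using difference_monotone_sum[of "{()}" "\<lambda>_. c" "\<lambda>_. f"] assms by simp

text \<open>The Leibniz rule for differences leaves the first factor shifted in one summand,
  so the class used for coinduction consists of finite sums of products.\<close>

lemma difference_monotone_mult:
  assumes "difference_monotone f" "difference_monotone g"
  shows "difference_monotone (\<lambda>x. f x * g x)"
proof (rule difference_monotone_coinduct[where
      X = "\<lambda>k. \<exists>F. (\<forall>(f, g)\<in>set F. difference_monotone f \<and> difference_monotone g) \<and>
             k = (\<lambda>x. \<Sum>(f, g)\<leftarrow>F. f x * g x)"])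
  show "\<exists>F. (\<forall>(f, g)\<in>set F. difference_monotone f \<and> difference_monotone g) \<and>
             (\<lambda>x. f x * g x) = (\<lambda>x. \<Sum>(f, g)\<leftarrow>F. f x * g x)"
    using assms by (intro exI[of _ "[(f, g)]"]) auto
next
  fix k :: "real ^ 'a \<Rightarrow> real" and x :: "real ^ 'a"
  assume "\<exists>F. (\<forall>(f, g)\<in>set F. difference_monotone f \<and> difference_monotone g) \<and>
             k = (\<lambda>x. \<Sum>(f, g)\<leftarrow>F. f x * g x)" and x: "x \<in> positive_orthant"
  then obtain F where F: "\<forall>(f, g)\<in>set F. difference_monotone f \<and> difference_monotone g"
    "k = (\<lambda>x. \<Sum>(f, g)\<leftarrow>F. f x * g x)"
    by auto
  show "0 \<le> k x"
    unfolding F(2) using F(1) x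
    by (intro sum_list_nonneg) (auto dest!: bspec difference_monotone_nonneg[OF _ x])
next
  fix k :: "real ^ 'a \<Rightarrow> real" and i :: 'a and h :: real
  assume "\<exists>F. (\<forall>(f, g)\<in>set F. difference_monotone f \<and> difference_monotone g) \<and>
             k = (\<lambda>x. \<Sum>(f, g)\<leftarrow>F. f x * g x)" and h: "0 \<le> h"
  then obtain F where F: "\<forall>(f, g)\<in>set F. difference_monotone f \<and> difference_monotone g"
    and k: "k = (\<lambda>x. \<Sum>(f, g)\<leftarrow>F. f x * g x)"
    by auto
  define G where "G = concat (map (\<lambda>(f, g). [(forward_drop i h f, g),
    (\<lambda>x. f (x + h *\<^sub>R axis i 1), forward_drop i h g)]) F)"
  have "\<forall>(f, g)\<in>set G. difference_monotone f \<and> difference_monotone g"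
    using F h unfolding G_def
    by (fastforce intro: difference_monotone_shift difference_monotone_forward_drop)
  moreover have "forward_drop i h k x = (\<Sum>(f, g)\<leftarrow>G. f x * g x)" for x
    unfolding k G_def forward_drop_def by (induction F) (auto simp: forward_drop_def algebra_simps)
  ultimately show "\<exists>F. (\<forall>(f, g)\<in>set F. difference_monotone f \<and> difference_monotone g) \<and>
             forward_drop i h k = (\<lambda>x. \<Sum>(f, g)\<leftarrow>F. f x * g x)"
    by blast
qed

lemma difference_monotone_LIMSEQ:
  assumes "\<And>k. difference_monotone (g k)"
    and "\<And>x. x \<in> positive_orthant \<Longrightarrow> (\<lambda>k. g k x) \<longlonglongrightarrow> f x"
  shows "difference_monotone f"
proof (rule difference_monotone_coinduct[where
      X = "\<lambda>f. \<exists>g. (\<forall>k. difference_monotone (g k)) \<and> (\<forall>x\<in>positive_orthant. (\<lambda>k. g k x) \<longlonglongrightarrow> f x)"])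
  fix f :: "real ^ 'a \<Rightarrow> real" and x :: "real ^ 'a"
  assume "\<exists>g. (\<forall>k. difference_monotone (g k)) \<and> (\<forall>x\<in>positive_orthant. (\<lambda>k. g k x) \<longlonglongrightarrow> f x)"
    "x \<in> positive_orthant"
  then show "0 \<le> f x"
    by (meson LIMSEQ_le_const difference_monotone_nonneg)
next
  fix f :: "real ^ 'a \<Rightarrow> real" and i :: 'a and h :: real
  assume "\<exists>g. (\<forall>k. difference_monotone (g k)) \<and> (\<forall>x\<in>positive_orthant. (\<lambda>k. g k x) \<longlonglongrightarrow> f x)"
    and h: "0 \<le> h"
  then obtain g where g: "\<forall>k. difference_monotone (g k)"
    "\<forall>x\<in>positive_orthant. (\<lambda>k. g k x) \<longlonglongrightarrow> f x"
    by blast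
  have "\<forall>x\<in>positive_orthant. (\<lambda>k. forward_drop i h (g k) x) \<longlonglongrightarrow> forward_drop i h f x"
    unfolding forward_drop_def using g h by (auto intro!: tendsto_diff positive_orthant_shift)
  with g h show "\<exists>g. (\<forall>k. difference_monotone (g k)) \<and>
      (\<forall>x\<in>positive_orthant. (\<lambda>k. g k x) \<longlonglongrightarrow> forward_drop i h f x)"
    by (intro exI[of _ "\<lambda>k. forward_drop i h (g k)"]) (auto intro: difference_monotone_forward_drop)
qed (use assms in blast)

lemma difference_monotone_integral:
  fixes f :: "real ^ 'n \<Rightarrow> real"
  assumes "\<And>t. difference_monotone (g t)"
    and "\<And>x. x \<in> positive_orthant \<Longrightarrow> has_bochner_integral M (\<lambda>t. g t x) (f x)"
  shows "difference_monotone f"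
proof (rule difference_monotone_coinduct[where
      X = "\<lambda>f. \<exists>g. (\<forall>t. difference_monotone (g t)) \<and>
        (\<forall>x\<in>positive_orthant. has_bochner_integral M (\<lambda>t. g t x) (f x))"])
  fix f :: "real ^ 'n \<Rightarrow> real" and x :: "real ^ 'n"
  assume "\<exists>g. (\<forall>t. difference_monotone (g t)) \<and>
      (\<forall>x\<in>positive_orthant. has_bochner_integral M (\<lambda>t. g t x) (f x))" "x \<in> positive_orthant"
  then show "0 \<le> f x"
    by (metis (mono_tags, lifting) Bochner_Integration.integral_nonneg difference_monotone_nonneg has_bochner_integral_integral_eq)
next
  fix f :: "real ^ 'n \<Rightarrow> real" and i :: 'n and h :: real
  assume "\<exists>g. (\<forall>t. difference_monotone (g t)) \<and>
      (\<forall>x\<in>positive_orthant. has_bochner_integral M (\<lambda>t. g t x) (f x))"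
    and h: "0 \<le> h"
  then obtain g where g: "\<forall>t. difference_monotone (g t)"
    "\<forall>x\<in>positive_orthant. has_bochner_integral M (\<lambda>t. g t x) (f x)"
    by blast
  have "\<forall>x\<in>positive_orthant.
      has_bochner_integral M (\<lambda>t. forward_drop i h (g t) x) (forward_drop i h f x)"
    unfolding forward_drop_def using g h by (auto intro!: has_bochner_integral_diff positive_orthant_shift)
  with g h show "\<exists>g. (\<forall>t. difference_monotone (g t)) \<and>
      (\<forall>x\<in>positive_orthant. has_bochner_integral M (\<lambda>t. g t x) (forward_drop i h f x))"
    by (intro exI[of _ "\<lambda>t. forward_drop i h (g t)"]) (auto intro: difference_monotone_forward_drop)
qed (use assms in blast)

text \<open>A drop in direction \<open>i\<close> multiplies the exponential by the nonnegative
  constant \<open>1 - exp (- (h * a $ i))\<close>, so its nonnegative multiples form a class closed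
  under drops.\<close>

lemma difference_monotone_exp:
  fixes a :: "real ^ 'n::finite"
  assumes "\<And>i. 0 \<le> a $ i"
  shows "difference_monotone (\<lambda>x. exp (- (a \<bullet> x)))"
proof (rule difference_monotone_coinduct[where X = "\<lambda>f. \<exists>c\<ge>0. f = (\<lambda>x. c * exp (- (a \<bullet> x)))"])
  fix f :: "real ^ 'n \<Rightarrow> real" and i :: 'n and h :: real
  assume "\<exists>c\<ge>0. f = (\<lambda>x. c * exp (- (a \<bullet> x)))" and h: "0 \<le> h"
  then obtain c where c: "0 \<le> c" "f = (\<lambda>x. c * exp (- (a \<bullet> x)))" by blast
  have "forward_drop i h f = (\<lambda>x. c * (1 - exp (- (h * a $ i))) * exp (- (a \<bullet> x)))"
    by (auto simp: forward_drop_def c inner_add_right inner_axis algebra_simps simp flip: exp_add)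
  moreover have "0 \<le> c * (1 - exp (- (h * a $ i)))"
    using c h assms by simp
  ultimately show "\<exists>c\<ge>0. forward_drop i h f = (\<lambda>x. c * exp (- (a \<bullet> x)))" by blast
qed (auto intro: exI[of _ 1])

section \<open>Powers of Lorentzian quadratic forms\<close>

text \<open>Euler's integral for \<open>Gamma \<gamma>\<close> with \<open>c * t\<close> substituted
  for \<open>t\<close>. It presents a negative power of \<open>c\<close> as a nonnegative mixture of
  exponentials decaying in \<open>c\<close>.\<close>

lemma has_bochner_integral_powr_exp:
  fixes c \<gamma> :: real
  assumes "0 < c" "0 < \<gamma>"
  shows "has_bochner_integral lborel
    (\<lambda>t. indicator {0..} t * t powr (\<gamma> - 1) * exp (- (c * t))) (Gamma \<gamma> * c powr (- \<gamma>))"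
proof -
  have "has_bochner_integral lborel (\<lambda>t. indicator {0..} t * t powr (\<gamma> - 1) / exp t) (Gamma \<gamma>)"
  proof (rule has_bochner_integral_nn_integral)
    show "(\<integral>\<^sup>+ t. ennreal (indicator {0..} t * t powr (\<gamma> - 1) / exp t) \<partial>lborel) = ennreal (Gamma \<gamma>)"
      using Gamma_conv_nn_integral_real[OF \<open>0 < \<gamma>\<close>] by (simp add: Gamma_real_pos)
  qed (use assms in \<open>auto simp: Gamma_real_pos less_imp_le\<close>)
  then have "has_bochner_integral lborel
      (\<lambda>t. indicator {0..} (0 + c * t) * (0 + c * t) powr (\<gamma> - 1) / exp (0 + c * t)) (Gamma \<gamma> /\<^sub>R \<bar>c\<bar>)"
    using assms by (subst (asm) lborel_has_bochner_integral_real_affine_iff[of c _ _ 0]) auto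
  then have "has_bochner_integral lborel
      (\<lambda>t. c powr (1 - \<gamma>) * (indicator {0..} (0 + c * t) * (0 + c * t) powr (\<gamma> - 1) / exp (0 + c * t)))
      (c powr (1 - \<gamma>) * (Gamma \<gamma> /\<^sub>R \<bar>c\<bar>))"
    by (rule has_bochner_integral_mult_right)
  moreover have "c powr (1 - \<gamma>) * (indicator {0..} (0 + c * t) * (0 + c * t) powr (\<gamma> - 1) / exp (0 + c * t))
      = indicator {0..} t * t powr (\<gamma> - 1) * exp (- (c * t))" for t
  proof (cases "0 \<le> t")
    case True
    have "c powr (1 - \<gamma>) * c powr (\<gamma> - 1) = 1"
      using assms by (simp flip: powr_add)
    then show ?thesis using True assms by (simp add: powr_mult exp_minus field_simps)
  qed (use assms in \<open>simp add: zero_le_mult_iff\<close>)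
  moreover have "c powr (1 - \<gamma>) * (Gamma \<gamma> /\<^sub>R \<bar>c\<bar>) = Gamma \<gamma> * c powr (- \<gamma>)"
    using assms by (simp add: powr_diff powr_minus field_simps)
  ultimately show ?thesis by (simp only:)
qed

lemma has_bochner_integral_gaussian:
  fixes b c s :: real
  assumes "0 < c" "0 < s"
  shows "has_bochner_integral lborel (\<lambda>y. exp (b * y - c * y\<^sup>2 / (4 * s)))
    (sqrt (4 * pi * s) * (exp (s * b\<^sup>2 / c) * c powr (- (1 / 2))))"
proof -
  \<comment> \<open>Completing the square in \<open>y\<close> gives a normal density with this mean
    and standard deviation; \<open>C\<close> collects its normalising factor and the remainder
    \<open>exp (s * b\<^sup>2 / c)\<close>.\<close>
  define \<mu> \<sigma> where "\<mu> = 2 * s * b / c" and "\<sigma> = sqrt (2 * s / c)"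
  have \<sigma>: "0 < \<sigma>" "\<sigma>\<^sup>2 = 2 * s / c" using assms by (auto simp: \<sigma>_def)
  define C where "C = sqrt (2 * pi * \<sigma>\<^sup>2) * exp (s * b\<^sup>2 / c)"
  have "has_bochner_integral lborel (normal_density \<mu> \<sigma>) 1"
    using \<sigma> by (simp add: has_bochner_integral_iff)
  then have "has_bochner_integral lborel (\<lambda>y. C * normal_density \<mu> \<sigma> y) (C * 1)"
    by (rule has_bochner_integral_mult_right)
  moreover have "C * normal_density \<mu> \<sigma> y = exp (b * y - c * y\<^sup>2 / (4 * s))" for y
  proof -
    have "s * b\<^sup>2 / c - (y - \<mu>)\<^sup>2 / (2 * \<sigma>\<^sup>2) = b * y - c * y\<^sup>2 / (4 * s)"
      unfolding \<sigma>(2) \<mu>_def using assms by (simp add: field_simps power2_eq_square)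
    then have "exp (s * b\<^sup>2 / c) * exp (- (y - \<mu>)\<^sup>2 / (2 * \<sigma>\<^sup>2)) = exp (b * y - c * y\<^sup>2 / (4 * s))"
      by (simp flip: exp_add)
    then show ?thesis
      using \<sigma>(1) by (simp add: C_def normal_density_def)
  qed
  moreover have "C = sqrt (4 * pi * s) * (exp (s * b\<^sup>2 / c) * c powr (- (1 / 2)))"
    using assms by (simp add: C_def \<sigma> powr_minus powr_half_sqrt real_sqrt_divide real_sqrt_mult field_simps)
  ultimately show ?thesis by simp
qed

text \<open>The Gamma integral mixes the exponentials \<open>exp (- (p \<bullet> x * t))\<close>
  with nonnegative weights. It requires a positive exponent, so the constant case
  \<open>\<gamma> = 0\<close> is separate.\<close>

lemma difference_monotone_powr_inner:
  fixes p :: "real ^ 'n"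
  assumes "\<And>i. 0 \<le> p $ i" "p \<noteq> 0" "0 \<le> \<gamma>"
  shows "difference_monotone (\<lambda>x. (p \<bullet> x) powr (- \<gamma>))"
proof (cases "\<gamma> = 0")
  case True
  have "difference_monotone (\<lambda>x :: real ^ 'n. 1 :: real)"
    by (rule difference_monotone_const) simp
  then show ?thesis
    by (rule difference_monotone_cong) (use True inner_pos_orthant[OF assms(1,2)] in force)
next
  case False
  with assms have \<gamma>: "0 < \<gamma>" by simp
  have dm: "difference_monotone (\<lambda>x. Gamma \<gamma> * (p \<bullet> x) powr (- \<gamma>))"
  proof (rule difference_monotone_integral[where M = lborel and
        g = "\<lambda>t x. (indicator {0..} t * t powr (\<gamma> - 1)) * exp (- (p \<bullet> x * t))"])
    show "difference_monotone (\<lambda>x. (indicator {0..} t * t powr (\<gamma> - 1)) * exp (- (p \<bullet> x * t)))" for t :: real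
    proof (cases "0 \<le> t")
      case True
      have "difference_monotone (\<lambda>x. exp (- ((t *\<^sub>R p) \<bullet> x)))"
        using True assms by (intro difference_monotone_exp) auto
      then show ?thesis
        using True by (intro difference_monotone_cmult) (auto simp: mult.commute)
    qed (simp add: difference_monotone_const)
  qed (use has_bochner_integral_powr_exp \<gamma> inner_pos_orthant[OF assms(1,2)] in auto)
  show ?thesis
    using difference_monotone_cmult[OF _ dm, of "1 / Gamma \<gamma>"] Gamma_real_pos[OF \<gamma>] by simp
qed

text \<open>Linearising one square \<open>(l \<bullet> x)\<^sup>2\<close> by a Gaussian integral over \<open>y\<close> replaces the exponent \<open>a\<close>
  by \<open>a + y\<^sup>2 p / (4 s) - y l\<close>. The hypothesis on \<open>a\<close> survives this by completing the square
  in every coordinate, which keeps the final exponents nonnegative.\<close>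

lemma difference_monotone_exp_squares:
  fixes p a :: "real ^ 'n" and ls :: "(real ^ 'n) list"
  assumes "0 < s" and p: "\<And>i. 0 \<le> p $ i" "p \<noteq> 0"
    and "\<And>i. 0 \<le> a $ i" "\<And>i. s * (\<Sum>l\<leftarrow>ls. (l $ i)\<^sup>2) \<le> a $ i * p $ i"
  shows "difference_monotone (\<lambda>x. exp (- (a \<bullet> x)) * exp (s * (\<Sum>l\<leftarrow>ls. (l \<bullet> x)\<^sup>2) / (p \<bullet> x)) *
    (p \<bullet> x) powr (- (real (length ls) / 2)))"
  using assms(4,5)
proof (induction ls arbitrary: a)
  case Nil
  have "difference_monotone (\<lambda>x. exp (- (a \<bullet> x)))"
    using Nil by (intro difference_monotone_exp) auto
  then show ?case
    by (rule difference_monotone_cong) (use inner_pos_orthant[OF p] in force)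
next
  case (Cons l ls)
  define a' where "a' y = a + (y\<^sup>2 / (4 * s)) *\<^sub>R p - y *\<^sub>R l" for y
  define F where "F = (\<lambda>a ls x. exp (- (a \<bullet> x)) * exp (s * (\<Sum>l\<leftarrow>ls. (l \<bullet> x)\<^sup>2) / (p \<bullet> x)) *
    (p \<bullet> x) powr (- (real (length ls) / 2)))"
  have sq: "s * (\<Sum>l\<leftarrow>ls. (l $ i)\<^sup>2) \<le> a' y $ i * p $ i" for y i
  proof -
    have "a' y $ i * p $ i - s * (\<Sum>l\<leftarrow>ls. (l $ i)\<^sup>2) =
        (a $ i * p $ i - s * (\<Sum>l\<leftarrow>l # ls. (l $ i)\<^sup>2)) + (2 * s * l $ i - y * p $ i)\<^sup>2 / (4 * s)"
      using \<open>0 < s\<close> by (simp add: a'_def field_simps power2_eq_square)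
    moreover have "0 \<le> (2 * s * l $ i - y * p $ i)\<^sup>2 / (4 * s)"
      using \<open>0 < s\<close> by simp
    ultimately show ?thesis
      using Cons.prems(2)[of i] by linarith
  qed
  \<comment> \<open>Where \<open>p $ i\<close> vanishes, \<open>sq\<close> gives no control of
    \<open>a' y $ i\<close>, but the hypothesis on \<open>a\<close> then forces
    \<open>l $ i = 0\<close>, so that this coordinate of \<open>a\<close> does not change.\<close>
  have nonneg: "0 \<le> a' y $ i" for y i
  proof (cases "p $ i = 0")
    case True
    have "0 \<le> s * (\<Sum>l\<leftarrow>ls. (l $ i)\<^sup>2)"
      using \<open>0 < s\<close> by (intro mult_nonneg_nonneg sum_list_nonneg) auto
    then have "s * (l $ i)\<^sup>2 \<le> 0"
      using Cons.prems(2)[of i] True by (simp add: algebra_simps)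
    then have "l $ i = 0"
      using \<open>0 < s\<close> by (simp add: mult_le_0_iff)
    then show ?thesis using True Cons.prems(1)[of i] by (simp add: a'_def)
  next
    case False
    have "0 \<le> s * (\<Sum>l\<leftarrow>ls. (l $ i)\<^sup>2)"
      using \<open>0 < s\<close> by (intro mult_nonneg_nonneg sum_list_nonneg) auto
    then have "0 \<le> a' y $ i * p $ i" using sq[where y = y and i = i] by linarith
    then show ?thesis
      using False p(1)[of i] by (simp add: zero_le_mult_iff)
  qed
  have "difference_monotone (\<lambda>x. sqrt (4 * pi * s) * F a (l # ls) x)"
  proof (rule difference_monotone_integral)
    show "difference_monotone (F (a' y) ls)" for y
      unfolding F_def using Cons.IH[of "a' y"] nonneg sq by blast
    fix x :: "real ^ 'n" assume "x \<in> positive_orthant"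
    then have c: "0 < p \<bullet> x" by (rule inner_pos_orthant[OF p])
    have "has_bochner_integral lborel
        (\<lambda>y. F a ls x * exp ((l \<bullet> x) * y - (p \<bullet> x) * y\<^sup>2 / (4 * s)))
        (F a ls x * (sqrt (4 * pi * s) *
          (exp (s * (l \<bullet> x)\<^sup>2 / (p \<bullet> x)) * (p \<bullet> x) powr (- (1 / 2)))))"
      by (intro has_bochner_integral_mult_right has_bochner_integral_gaussian c \<open>0 < s\<close>)
    moreover have "F a ls x * exp ((l \<bullet> x) * y - (p \<bullet> x) * y\<^sup>2 / (4 * s)) = F (a' y) ls x" for y
    proof -
      have "- (a' y \<bullet> x) = - (a \<bullet> x) + ((l \<bullet> x) * y - (p \<bullet> x) * y\<^sup>2 / (4 * s))"
        by (simp add: a'_def inner_diff_left inner_add_left algebra_simps)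
      then have "exp (- (a' y \<bullet> x)) =
          exp (- (a \<bullet> x)) * exp ((l \<bullet> x) * y - (p \<bullet> x) * y\<^sup>2 / (4 * s))"
        by (simp only: exp_add)
      then show ?thesis by (simp add: F_def)
    qed
    moreover have "F a ls x * (sqrt (4 * pi * s) *
          (exp (s * (l \<bullet> x)\<^sup>2 / (p \<bullet> x)) * (p \<bullet> x) powr (- (1 / 2)))) =
        sqrt (4 * pi * s) * F a (l # ls) x"
    proof -
      have "(p \<bullet> x) powr (- (real (length (l # ls)) / 2)) =
          (p \<bullet> x) powr (- (real (length ls) / 2)) * (p \<bullet> x) powr (- (1 / 2))"
        unfolding powr_add[symmetric] by (rule arg_cong) (simp add: field_simps)
      moreover have "exp (s * (\<Sum>l\<leftarrow>l # ls. (l \<bullet> x)\<^sup>2) / (p \<bullet> x)) =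
          exp (s * (l \<bullet> x)\<^sup>2 / (p \<bullet> x)) * exp (s * (\<Sum>l\<leftarrow>ls. (l \<bullet> x)\<^sup>2) / (p \<bullet> x))"
        by (simp add: distrib_left add_divide_distrib flip: exp_add)
      ultimately show ?thesis by (simp add: F_def)
    qed
    ultimately show "has_bochner_integral lborel (\<lambda>y. F (a' y) ls x) (sqrt (4 * pi * s) * F a (l # ls) x)"
      by (simp only:)
  qed
  from difference_monotone_cmult[OF _ this, of "1 / sqrt (4 * pi * s)"]
  have "difference_monotone (F a (l # ls))"
    using \<open>0 < s\<close> by simp
  then show ?case unfolding F_def .
qed

text \<open>\<open>sq\<close> says that the quadratic form is nonnegative at every axis vector;
  scaled by \<open>s\<close>, it becomes the hypothesis of
  \<open>difference_monotone_exp_squares\<close> for the exponent \<open>s *\<^sub>R r\<close>. The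
  lower bound on \<open>\<beta>\<close> makes the remaining power of \<open>p \<bullet> x\<close>
  difference monotone.\<close>

lemma difference_monotone_powr_quadratic:
  fixes p r :: "real ^ 'n" and ls :: "(real ^ 'n) list"
  assumes p: "\<And>i. 0 \<le> p $ i" "p \<noteq> 0" and r: "\<And>i. 0 \<le> r $ i"
    and sq: "\<And>i. (\<Sum>l\<leftarrow>ls. (l $ i)\<^sup>2) \<le> r $ i * p $ i"
    and pos: "\<And>x. x \<in> positive_orthant \<Longrightarrow> (\<Sum>l\<leftarrow>ls. (l \<bullet> x)\<^sup>2) < (r \<bullet> x) * (p \<bullet> x)"
    and "0 < \<beta>" "real (length ls) / 2 \<le> \<beta>"
  shows "difference_monotone (\<lambda>x. ((r \<bullet> x) * (p \<bullet> x) - (\<Sum>l\<leftarrow>ls. (l \<bullet> x)\<^sup>2)) powr (- \<beta>))"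
proof -
  define q where "q x = (\<Sum>l\<leftarrow>ls. (l \<bullet> x)\<^sup>2)" for x
  have E: "difference_monotone (\<lambda>x. exp (s * q x / (p \<bullet> x) - s * (r \<bullet> x)) * (p \<bullet> x) powr (- \<beta>))"
    if "0 < s" for s
  proof -
    have "difference_monotone (\<lambda>x. (exp (- ((s *\<^sub>R r) \<bullet> x)) *
        exp (s * (\<Sum>l\<leftarrow>ls. (l \<bullet> x)\<^sup>2) / (p \<bullet> x)) * (p \<bullet> x) powr (- (real (length ls) / 2))) *
        (p \<bullet> x) powr (- (\<beta> - real (length ls) / 2)))"
      using that r sq assms(7)
      by (intro difference_monotone_mult difference_monotone_exp_squares
          difference_monotone_powr_inner p) auto
    then show ?thesis
    proof (rule difference_monotone_cong)
      fix x :: "real ^ 'n"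
      have "(p \<bullet> x) powr (- \<beta>) = (p \<bullet> x) powr (- (real (length ls) / 2)) *
          (p \<bullet> x) powr (- (\<beta> - real (length ls) / 2))"
        by (simp flip: powr_add)
      moreover have "exp (s * q x / (p \<bullet> x) - s * (r \<bullet> x)) =
          exp (- ((s *\<^sub>R r) \<bullet> x)) * exp (s * (\<Sum>l\<leftarrow>ls. (l \<bullet> x)\<^sup>2) / (p \<bullet> x))"
        by (simp add: q_def flip: exp_add)
      ultimately show "(exp (- ((s *\<^sub>R r) \<bullet> x)) *
        exp (s * (\<Sum>l\<leftarrow>ls. (l \<bullet> x)\<^sup>2) / (p \<bullet> x)) * (p \<bullet> x) powr (- (real (length ls) / 2))) *
        (p \<bullet> x) powr (- (\<beta> - real (length ls) / 2)) =
        exp (s * q x / (p \<bullet> x) - s * (r \<bullet> x)) * (p \<bullet> x) powr (- \<beta>)"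
        by (simp only: mult_ac)
    qed
  qed
  have dm: "difference_monotone (\<lambda>x. Gamma \<beta> * ((r \<bullet> x) * (p \<bullet> x) - q x) powr (- \<beta>))"
  proof (rule difference_monotone_integral)
    show "difference_monotone (\<lambda>x. (indicator {0..} s * s powr (\<beta> - 1)) *
        (exp (s * q x / (p \<bullet> x) - s * (r \<bullet> x)) * (p \<bullet> x) powr (- \<beta>)))" for s :: real
    proof (cases "0 < s")
      case True
      then show ?thesis by (intro difference_monotone_cmult E) auto
    next
      \<comment> \<open>For negative \<open>s\<close> the indicator vanishes; at
        \<open>s = 0\<close> the convention that a power of \<open>0\<close> is \<open>0\<close>
        does the same.\<close>
      case False
      then have "(indicator {0..} s * s powr (\<beta> - 1)) = 0"
        by (cases "s = 0") auto
      then show ?thesis by (simp only: mult_zero_left difference_monotone_const order_refl)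
    qed
    fix x :: "real ^ 'n" assume x: "x \<in> positive_orthant"
    then have c: "0 < p \<bullet> x" by (rule inner_pos_orthant[OF p])
    \<comment> \<open>\<open>t\<close> is the quadratic form divided by
      \<open>p \<bullet> x\<close>. The power of the form factors accordingly, and the Gamma
      integral is applied to the power of \<open>t\<close> alone.\<close>
    define t where "t = r \<bullet> x - q x / (p \<bullet> x)"
    have t: "0 < t" "t * (p \<bullet> x) = (r \<bullet> x) * (p \<bullet> x) - q x"
      using c pos[OF x] by (auto simp: t_def q_def field_simps)
    have "has_bochner_integral lborel
       (\<lambda>s. (indicator {0..} s * s powr (\<beta> - 1) * exp (- (t * s))) * (p \<bullet> x) powr (- \<beta>))
       ((Gamma \<beta> * t powr (- \<beta>)) * (p \<bullet> x) powr (- \<beta>))"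
      by (intro has_bochner_integral_mult_left has_bochner_integral_powr_exp t \<open>0 < \<beta>\<close>)
    moreover have "t powr (- \<beta>) * (p \<bullet> x) powr (- \<beta>) = ((r \<bullet> x) * (p \<bullet> x) - q x) powr (- \<beta>)"
      using t c by (simp flip: powr_mult)
    moreover have "- (t * s) = s * q x / (p \<bullet> x) - s * (r \<bullet> x)" for s
      by (simp add: t_def algebra_simps)
    ultimately show "has_bochner_integral lborel (\<lambda>s. (indicator {0..} s * s powr (\<beta> - 1)) *
        (exp (s * q x / (p \<bullet> x) - s * (r \<bullet> x)) * (p \<bullet> x) powr (- \<beta>)))
        (Gamma \<beta> * ((r \<bullet> x) * (p \<bullet> x) - q x) powr (- \<beta>))"
      by (simp only: mult.assoc)
  qed
  show ?thesis
    using difference_monotone_cmult[OF _ dm, of "1 / Gamma \<beta>"] Gamma_real_pos[OF \<open>0 < \<beta>\<close>]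
    by (simp add: q_def)
qed

text \<open>The contrasts of the Helmert matrix, built one index at a time: they split the mean off
  a sum of squares and leave one square fewer than there are indices.\<close>

lemma sum_squares_helmert:
  fixes A :: "'n::finite set"
  assumes "finite A" "A \<noteq> {}"
  shows "\<exists>ls :: (real ^ 'n) list. length ls = card A - 1 \<and>
    (\<forall>x. (\<Sum>i\<in>A. (x $ i)\<^sup>2) = (\<Sum>i\<in>A. x $ i)\<^sup>2 / card A + (\<Sum>l\<leftarrow>ls. (l \<bullet> x)\<^sup>2))"
  using assms
proof (induction A rule: finite_ne_induct)
  case (singleton i)
  then show ?case by (intro exI[of _ "[]"]) simp
next
  case (insert j A)
  then obtain ls :: "(real ^ 'n) list" where ls: "length ls = card A - 1"
    "\<And>x. (\<Sum>i\<in>A. (x $ i)\<^sup>2) = (\<Sum>i\<in>A. x $ i)\<^sup>2 / card A + (\<Sum>l\<leftarrow>ls. (l \<bullet> x)\<^sup>2)"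
    by blast
  define m where "m = real (card A)"
  have m: "0 < m" using insert by (simp add: m_def card_gt_0_iff)
  \<comment> \<open>\<open>l\<close> is the contrast between the sum over \<open>A\<close> and the
    new index \<open>j\<close>; the factor \<open>c\<close> gives it unit length.\<close>
  define c where "c = 1 / sqrt (m * (m + 1))"
  have c: "c\<^sup>2 = 1 / (m * (m + 1))" using m by (simp add: c_def power_divide)
  define l :: "real ^ 'n" where "l = c *\<^sub>R ((\<Sum>i\<in>A. axis i 1) - m *\<^sub>R axis j 1)"
  have l: "(l \<bullet> x)\<^sup>2 = ((\<Sum>i\<in>A. x $ i) - m * x $ j)\<^sup>2 / (m * (m + 1))" for x
    by (simp add: l_def power_mult_distrib c inner_diff_left inner_sum_left inner_axis')
  have "(\<Sum>i\<in>insert j A. (x $ i)\<^sup>2) = (\<Sum>i\<in>insert j A. x $ i)\<^sup>2 / card (insert j A) +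
      (\<Sum>l\<leftarrow>l # ls. (l \<bullet> x)\<^sup>2)" for x
  proof -
    define S where "S = (\<Sum>i\<in>A. x $ i)"
    have "(x $ j)\<^sup>2 + S\<^sup>2 / m = (x $ j + S)\<^sup>2 / (m + 1) + (S - m * x $ j)\<^sup>2 / (m * (m + 1))"
      using m by (simp add: divide_simps) (simp add: algebra_simps power2_eq_square)
    then show ?thesis
      using insert.hyps ls(2)[of x] by (simp add: l S_def m_def add_ac)
  qed
  moreover have "length (l # ls) = card (insert j A) - 1"
    using insert.hyps ls(1) m by (simp add: m_def)
  ultimately show ?case by blast
qed

section \<open>Smooth functions on the orthant\<close>

lemma open_positive_orthant: "open (positive_orthant :: (real ^ 'n) set)"
proof -
  have *: "positive_orthant = (\<Inter>i\<in>UNIV. {x :: real ^ 'n. 0 < x $ i})"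
    by (auto simp: positive_orthant_def)
  show ?thesis
    unfolding * by (intro open_INT ballI open_halfspace_component_gt_cart finite)
qed

lemma eventually_positive_orthant:
  fixes x :: "real ^ 'n"
  assumes "x \<in> positive_orthant"
  shows "\<forall>\<^sub>F t in nhds 0. x + t *\<^sub>R axis i 1 \<in> positive_orthant"
proof -
  have "((\<lambda>t. x + t *\<^sub>R axis i 1) \<longlongrightarrow> x + 0 *\<^sub>R axis i 1) (nhds 0)"
    by (intro tendsto_intros filterlim_ident)
  then show ?thesis
    using topological_tendstoD[OF _ open_positive_orthant] assms by fastforce
qed

lemma partial_deriv_cong:
  assumes "\<And>x. x \<in> positive_orthant \<Longrightarrow> f x = g x" "x \<in> positive_orthant"
  shows "partial_deriv i f x = partial_deriv i g x"
  unfolding partial_deriv_def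
  using eventually_positive_orthant[OF assms(2), of i] assms(1)
  by (intro deriv_cong_ev) (auto elim: eventually_mono)

lemma partial_differentiable_cong:
  assumes "\<And>x. x \<in> positive_orthant \<Longrightarrow> f x = g x" "x \<in> positive_orthant"
  shows "(\<lambda>t. f (x + t *\<^sub>R axis i 1)) field_differentiable at 0 \<longleftrightarrow>
    (\<lambda>t. g (x + t *\<^sub>R axis i 1)) field_differentiable at 0"
  unfolding field_differentiable_def
  using eventually_positive_orthant[OF assms(2), of i] assms(1)
  by (intro ex_cong1 has_field_derivative_cong_ev) (auto elim: eventually_mono)

lemma partial_deriv_eq:
  assumes "((\<lambda>t. f (x + t *\<^sub>R axis i 1)) has_field_derivative D) (at 0)"
  shows "partial_deriv i f x = D"
  using assms unfolding partial_deriv_def by (rule DERIV_imp_deriv)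

lemma iter_partial_Nil: "iter_partial [] f = f"
  and iter_partial_Cons: "iter_partial (i # is) f = partial_deriv i (iter_partial is f)"
  by (simp_all add: iter_partial_def)

text \<open>If a family of continuous functions is closed under partial derivatives, every iterated
  partial derivative of a member agrees on the open orthant with some member.\<close>

lemma C_infinity_onI:
  assumes "f \<in> \<F>"
    and continuous: "\<And>g. g \<in> \<F> \<Longrightarrow> continuous_on positive_orthant g"
    and derivative: "\<And>g i. g \<in> \<F> \<Longrightarrow> \<exists>g'\<in>\<F>. \<forall>x\<in>positive_orthant.
      ((\<lambda>t. g (x + t *\<^sub>R axis i 1)) has_field_derivative g' x) (at 0)"
  shows "C_infinity_on positive_orthant f"
proof -
  have *: "\<exists>g\<in>\<F>. \<forall>x\<in>positive_orthant. iter_partial is f x = g x" for "is"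
  proof (induction "is")
    case Nil
    then show ?case using \<open>f \<in> \<F>\<close> by (auto simp: iter_partial_Nil)
  next
    case (Cons i "is")
    then obtain g where g: "g \<in> \<F>" "\<And>x. x \<in> positive_orthant \<Longrightarrow> iter_partial is f x = g x"
      by blast
    then show ?case
      using derivative[OF g(1), of i] partial_deriv_cong[of _ g] partial_deriv_eq
      by (metis iter_partial_Cons)
  qed
  show ?thesis
    unfolding C_infinity_on_def
  proof (intro allI conjI ballI)
    fix "is" :: "'a list"
    obtain g where g: "g \<in> \<F>" "\<And>x. x \<in> positive_orthant \<Longrightarrow> iter_partial is f x = g x"
      using * by blast
    then show "continuous_on positive_orthant (iter_partial is f)"
      using continuous[OF g(1)] by (simp cong: continuous_on_cong)
    fix i and x :: "real ^ 'a" assume "x \<in> positive_orthant"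
    then show "(\<lambda>t. iter_partial is f (x + t *\<^sub>R axis i 1)) field_differentiable at 0"
      using derivative[OF g(1), of i] partial_differentiable_cong[of "iter_partial is f" g x] g(2)
      by (auto simp: field_differentiable_def)
  qed
qed

lemma C_infinity_on_differentiable:
  assumes "C_infinity_on positive_orthant f" "x \<in> positive_orthant"
  shows "((\<lambda>t. iter_partial is f (x + t *\<^sub>R axis i 1)) has_field_derivative
    iter_partial (i # is) f x) (at 0)"
  using assms unfolding C_infinity_on_def iter_partial_Cons partial_deriv_def
  by (simp add: field_differentiable_derivI)

lemma C_infinity_on_differentiable_along:
  assumes "C_infinity_on positive_orthant f" "x + s *\<^sub>R axis i 1 \<in> positive_orthant"
  shows "((\<lambda>t. iter_partial is f (x + t *\<^sub>R axis i 1)) has_field_derivative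
    iter_partial (i # is) f (x + s *\<^sub>R axis i 1)) (at s)"
proof -
  have "((\<lambda>t. iter_partial is f ((x + s *\<^sub>R axis i 1) + t *\<^sub>R axis i 1)) has_field_derivative
      iter_partial (i # is) f (x + s *\<^sub>R axis i 1)) (at 0)"
    by (rule C_infinity_on_differentiable[OF assms])
  then show ?thesis
    using DERIV_shift[of "\<lambda>t. iter_partial is f (x + t *\<^sub>R axis i 1)" _ 0 s]
    by (simp add: algebra_simps)
qed

section \<open>Passage between differences and derivatives\<close>

lemma difference_monotone_partial_deriv:
  assumes "difference_monotone g"
    and "\<And>x. x \<in> positive_orthant \<Longrightarrow>
      ((\<lambda>t. g (x + t *\<^sub>R axis i 1)) has_field_derivative g' x) (at 0)"
  shows "difference_monotone (\<lambda>x. - g' x)"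
proof (rule difference_monotone_LIMSEQ)
  \<comment> \<open>These scaled drops are difference quotients with reversed sign; they stay in the
    class and converge to \<open>- g' x\<close>.\<close>
  show "difference_monotone (\<lambda>x. real (Suc k) * forward_drop i (1 / real (Suc k)) g x)" for k
    using assms(1) by (intro difference_monotone_cmult difference_monotone_forward_drop) auto
  fix x :: "real ^ 'a" assume "x \<in> positive_orthant"
  from assms(2)[OF this]
  have "((\<lambda>t. (g (x + t *\<^sub>R axis i 1) - g x) / t) \<longlongrightarrow> g' x) (at 0)"
    by (simp add: DERIV_def)
  moreover have "filterlim (\<lambda>k. 1 / real (Suc k)) (at 0) sequentially"
    unfolding filterlim_at using LIMSEQ_Suc[OF lim_1_over_n] by auto
  ultimately have "(\<lambda>k. (g (x + (1 / real (Suc k)) *\<^sub>R axis i 1) - g x) / (1 / real (Suc k)))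
      \<longlonglongrightarrow> g' x"
    by (rule filterlim_compose)
  from tendsto_minus[OF this]
  show "(\<lambda>k. real (Suc k) * forward_drop i (1 / real (Suc k)) g x) \<longlonglongrightarrow> - g' x"
    by (simp add: forward_drop_def algebra_simps)
qed

lemma completely_monotoneI:
  assumes "C_infinity_on positive_orthant f" "difference_monotone f"
  shows "completely_monotone f"
proof -
  have "difference_monotone (\<lambda>x. (- 1) ^ length is * iter_partial is f x)" for "is"
  proof (induction "is")
    case Nil
    then show ?case using assms by (simp add: iter_partial_Nil)
  next
    case (Cons i "is")
    have "difference_monotone (\<lambda>x. - ((- 1) ^ length is * iter_partial (i # is) f x))"
      by (rule difference_monotone_partial_deriv[OF Cons, of i])
        (intro DERIV_cmult C_infinity_on_differentiable assms(1))
    then show ?case by simp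
  qed
  then show ?thesis
    unfolding completely_monotone_def using assms(1) difference_monotone_nonneg by blast
qed

lemma forward_drop_mean_value:
  assumes "C_infinity_on positive_orthant f" "x \<in> positive_orthant" "0 \<le> h"
  shows "\<exists>t\<in>{0..h}. forward_drop i h (iter_partial is f) x =
    - h * iter_partial (i # is) f (x + t *\<^sub>R axis i 1)"
proof (cases "h = 0")
  case False
  with assms have "0 < h" by simp
  have "\<exists>t>0. t < h \<and> iter_partial is f (x + h *\<^sub>R axis i 1) - iter_partial is f (x + 0 *\<^sub>R axis i 1) =
      (h - 0) * iter_partial (i # is) f (x + t *\<^sub>R axis i 1)"
    using assms by (intro MVT2 \<open>0 < h\<close> C_infinity_on_differentiable_along positive_orthant_shift) auto
  then obtain t where t: "0 < t" "t < h" "iter_partial is f (x + h *\<^sub>R axis i 1) - iter_partial is f x =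
      h * iter_partial (i # is) f (x + t *\<^sub>R axis i 1)"
    by auto
  then show ?thesis by (intro bexI[of _ t]) (auto simp: forward_drop_def)
qed (auto simp: forward_drop_def)

lemma forward_drop_derivative:
  assumes f: "C_infinity_on positive_orthant f" and x: "x \<in> positive_orthant" and h: "0 \<le> h"
  shows "((\<lambda>t. forward_drop i h (iter_partial is f) (x + t *\<^sub>R axis j 1)) has_field_derivative
    forward_drop i h (iter_partial (j # is) f) x) (at 0)"
proof -
  have "((\<lambda>t. iter_partial is f (x + t *\<^sub>R axis j 1) -
      iter_partial is f ((x + h *\<^sub>R axis i 1) + t *\<^sub>R axis j 1)) has_field_derivative
      iter_partial (j # is) f x - iter_partial (j # is) f (x + h *\<^sub>R axis i 1)) (at 0)"
    by (intro DERIV_diff C_infinity_on_differentiable f x h positive_orthant_shift)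
  then show ?thesis by (simp add: forward_drop_def algebra_simps)
qed

lemma iter_partial_forward_drop:
  assumes f: "C_infinity_on positive_orthant f" and "x \<in> positive_orthant" and h: "0 \<le> h"
  shows "iter_partial is (forward_drop i h f) x = forward_drop i h (iter_partial is f) x"
  using assms(2)
proof (induction "is" arbitrary: x)
  case (Cons j "is")
  then have "iter_partial (j # is) (forward_drop i h f) x =
      partial_deriv j (forward_drop i h (iter_partial is f)) x"
    unfolding iter_partial_Cons by (intro partial_deriv_cong) auto
  also have "\<dots> = forward_drop i h (iter_partial (j # is) f) x"
    by (intro partial_deriv_eq forward_drop_derivative f h Cons.prems)
  finally show ?case .
qed (simp add: iter_partial_Nil)

lemma C_infinity_on_forward_drop:
  assumes f: "C_infinity_on positive_orthant f" and h: "0 \<le> h"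
  shows "C_infinity_on positive_orthant (forward_drop i h f)"
  unfolding C_infinity_on_def
proof (intro allI conjI ballI)
  fix "is"
  have cont: "continuous_on positive_orthant (iter_partial is f)"
    using f by (simp add: C_infinity_on_def)
  have "continuous_on positive_orthant (forward_drop i h (iter_partial is f))"
    unfolding forward_drop_def using positive_orthant_shift[OF _ h]
    by (intro continuous_on_diff cont continuous_on_compose2[OF cont] continuous_intros) auto
  then show "continuous_on positive_orthant (iter_partial is (forward_drop i h f))"
    by (simp add: iter_partial_forward_drop[OF f _ h] cong: continuous_on_cong)
  fix j and x :: "real ^ 'a" assume x: "x \<in> positive_orthant"
  have "(\<lambda>t. forward_drop i h (iter_partial is f) (x + t *\<^sub>R axis j 1)) field_differentiable at 0"
    using forward_drop_derivative[OF f x h] unfolding field_differentiable_def by blast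
  then show "(\<lambda>t. iter_partial is (forward_drop i h f) (x + t *\<^sub>R axis j 1)) field_differentiable at 0"
    using partial_differentiable_cong[where g = "forward_drop i h (iter_partial is f)"
        and f = "iter_partial is (forward_drop i h f)" and i = j, OF _ x]
      iter_partial_forward_drop[OF f _ h] by blast
qed

text \<open>Complete monotonicity is itself closed under drops: derivatives commute with a drop, and
  by the mean value theorem a drop of a derivative is \<open>- h\<close> times a derivative of one
  order more at a point of the orthant.\<close>

lemma completely_monotone_imp_difference_monotone:
  assumes "completely_monotone f"
  shows "difference_monotone f"
proof (rule difference_monotone_coinduct[where X = completely_monotone])
  fix f :: "real ^ 'a \<Rightarrow> real" and x :: "real ^ 'a"
  assume "completely_monotone f" "x \<in> positive_orthant"
  then have "0 \<le> (- 1) ^ length ([] :: 'a list) * iter_partial [] f x"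
    unfolding completely_monotone_def by blast
  then show "0 \<le> f x" by (simp add: iter_partial_Nil)
next
  fix f :: "real ^ 'a \<Rightarrow> real" and i :: 'a and h :: real
  assume f: "completely_monotone f" and h: "0 \<le> h"
  then have smooth: "C_infinity_on positive_orthant f" by (simp add: completely_monotone_def)
  have "0 \<le> (- 1) ^ length is * iter_partial is (forward_drop i h f) x"
    if x: "x \<in> positive_orthant" for "is" x
  proof -
    obtain t where t: "t \<in> {0..h}" "forward_drop i h (iter_partial is f) x =
        - h * iter_partial (i # is) f (x + t *\<^sub>R axis i 1)"
      using forward_drop_mean_value[OF smooth x h] by blast
    have "0 \<le> (- 1) ^ length (i # is) * iter_partial (i # is) f (x + t *\<^sub>R axis i 1)"
      using f t positive_orthant_shift[OF x, of t i] unfolding completely_monotone_def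
      by (meson atLeastAtMost_iff)
    with h have "0 \<le> h * ((- 1) ^ length (i # is) * iter_partial (i # is) f (x + t *\<^sub>R axis i 1))"
      by (rule mult_nonneg_nonneg)
    then show ?thesis
      by (simp add: iter_partial_forward_drop[OF smooth x h] t(2) mult_ac)
  qed
  then show "completely_monotone (forward_drop i h f)"
    unfolding completely_monotone_def using C_infinity_on_forward_drop[OF smooth h] by blast
qed fact

text \<open>The induction treats the first drop of \<open>f\<close> as a new smooth function. That
  drop commutes with the remaining derivatives, and one more mean value step replaces it by a
  derivative while moving the point by at most \<open>h\<close>.\<close>

lemma iter_drop_mean_value:
  assumes "C_infinity_on positive_orthant f" "x \<in> positive_orthant" "0 \<le> h"
  shows "\<exists>\<xi>\<in>positive_orthant. dist x \<xi> \<le> real (length is) * h \<and>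
    iter_drop (map (\<lambda>i. (i, h)) is) f x = (- h) ^ length is * iter_partial is f \<xi>"
  using assms(1)
proof (induction "is" arbitrary: f)
  case Nil
  then show ?case using assms by (auto simp: iter_partial_Nil)
next
  case (Cons i "is")
  obtain \<xi> where \<xi>: "\<xi> \<in> positive_orthant" "dist x \<xi> \<le> real (length is) * h"
    "iter_drop (map (\<lambda>i. (i, h)) is) (forward_drop i h f) x =
      (- h) ^ length is * iter_partial is (forward_drop i h f) \<xi>"
    using Cons.IH[OF C_infinity_on_forward_drop[OF Cons.prems assms(3)]] by blast
  obtain t where t: "t \<in> {0..h}" "forward_drop i h (iter_partial is f) \<xi> =
      - h * iter_partial (i # is) f (\<xi> + t *\<^sub>R axis i 1)"
    using forward_drop_mean_value[OF Cons.prems \<xi>(1) assms(3)] by blast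
  have "dist \<xi> (\<xi> + t *\<^sub>R axis i 1) \<le> h"
    using t by (simp add: dist_norm norm_axis_1)
  with \<xi>(2) have "dist x (\<xi> + t *\<^sub>R axis i 1) \<le> real (length (i # is)) * h"
    using dist_triangle[of x "\<xi> + t *\<^sub>R axis i 1" \<xi>] by (simp add: distrib_right)
  moreover have "\<xi> + t *\<^sub>R axis i 1 \<in> positive_orthant"
    using \<xi>(1) t(1) by (auto intro: positive_orthant_shift)
  moreover have "iter_drop (map (\<lambda>i. (i, h)) (i # is)) f x =
      (- h) ^ length (i # is) * iter_partial (i # is) f (\<xi> + t *\<^sub>R axis i 1)"
    using \<xi>(3) iter_partial_forward_drop[OF Cons.prems \<xi>(1) assms(3)] t(2) by simp
  ultimately show ?case by blast
qed

text \<open>The intermediate points of \<open>iter_drop_mean_value\<close> tend to \<open>x\<close>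
  with \<open>h\<close>, and iterated derivatives are continuous. Sign conditions on differences
  thus pass to derivatives of any order.\<close>

lemma iter_drop_quotient_tendsto:
  assumes "C_infinity_on positive_orthant f" "x \<in> positive_orthant"
  shows "((\<lambda>h. iter_drop (map (\<lambda>i. (i, h)) is) f x / h ^ length is) \<longlongrightarrow>
    (- 1) ^ length is * iter_partial is f x) (at_right 0)"
proof -
  have "\<forall>h\<in>{0..}. \<exists>\<xi>. \<xi> \<in> positive_orthant \<and> dist x \<xi> \<le> real (length is) * h \<and>
      iter_drop (map (\<lambda>i. (i, h)) is) f x = (- h) ^ length is * iter_partial is f \<xi>"
    using iter_drop_mean_value[OF assms] by force
  from bchoice[OF this] obtain \<xi> where \<xi>: "\<And>h. 0 \<le> h \<Longrightarrow> \<xi> h \<in> positive_orthant \<and> dist x (\<xi> h) \<le> real (length is) * h \<and>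
    iter_drop (map (\<lambda>i. (i, h)) is) f x = (- h) ^ length is * iter_partial is f (\<xi> h)"
    by auto
  have "((\<lambda>h. real (length is) * h) \<longlongrightarrow> real (length is) * 0) (at_right 0)"
    by (intro tendsto_intros)
  then have upper: "((\<lambda>h. real (length is) * h) \<longlongrightarrow> 0) (at_right 0)" by simp
  have "\<forall>\<^sub>F h in at_right 0. dist x (\<xi> h) \<le> real (length is) * h"
    using \<xi> by (auto simp: eventually_at_filter)
  then have "((\<lambda>h. dist x (\<xi> h)) \<longlongrightarrow> 0) (at_right 0)"
    by (intro tendsto_sandwich[OF _ _ tendsto_const upper]) auto
  then have lim: "(\<xi> \<longlongrightarrow> x) (at_right 0)"
    by (simp add: tendsto_dist_iff[of \<xi>] dist_commute)
  have cont: "isCont (iter_partial is f) x"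
  proof -
    have "continuous_on positive_orthant (iter_partial is f)"
      using assms(1) unfolding C_infinity_on_def by blast
    then show ?thesis
      by (rule continuous_on_interior) (simp add: interior_open open_positive_orthant assms(2))
  qed
  have "((\<lambda>h. (- 1) ^ length is * iter_partial is f (\<xi> h)) \<longlongrightarrow>
      (- 1) ^ length is * iter_partial is f x) (at_right 0)"
    by (rule tendsto_mult_left[OF isCont_tendsto_compose[OF cont lim]])
  moreover have "(- 1) ^ length is * iter_partial is f (\<xi> h) =
      iter_drop (map (\<lambda>i. (i, h)) is) f x / h ^ length is" if "0 < h" for h
    using \<xi>[of h] that power_minus[of h "length is"] by simp
  then have "\<forall>\<^sub>F h in at_right 0. (- 1) ^ length is * iter_partial is f (\<xi> h) =
      iter_drop (map (\<lambda>i. (i, h)) is) f x / h ^ length is"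
    using eventually_at_right_less[of 0] by (auto elim: eventually_mono)
  ultimately show ?thesis by (rule Lim_transform_eventually)
qed

section \<open>Powers of the second elementary symmetric polynomial\<close>

lemma E2_eq:
  fixes x :: "real ^ 'n::{finite, linorder}"
  shows "E2 x = ((\<Sum>i\<in>UNIV. x $ i)\<^sup>2 - (\<Sum>i\<in>UNIV. (x $ i)\<^sup>2)) / 2"
proof -
  let ?f = "\<lambda>(i, j). x $ i * x $ j"
  let ?L = "{(i :: 'n, j). i < j}" and ?G = "{(i :: 'n, j). j < i}" and ?D = "{(i :: 'n, j). i = j}"
  have "UNIV = ?L \<union> (?G \<union> ?D)" by auto
  moreover have "(\<Sum>i\<in>UNIV. x $ i)\<^sup>2 = sum ?f UNIV"
    by (simp add: power2_eq_square sum_product sum.cartesian_product)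
  ultimately have "(\<Sum>i\<in>UNIV. x $ i)\<^sup>2 = sum ?f (?L \<union> (?G \<union> ?D))" by simp
  also have "\<dots> = sum ?f ?L + (sum ?f ?G + sum ?f ?D)"
    by (subst sum.union_disjoint; (subst sum.union_disjoint)?) auto
  also have "sum ?f ?G = sum ?f ?L"
    by (rule sum.reindex_bij_witness[of _ prod.swap prod.swap]) (auto simp: mult.commute)
  also have "sum ?f ?D = (\<Sum>i\<in>UNIV. (x $ i)\<^sup>2)"
    by (rule sum.reindex_bij_witness[of _ "\<lambda>i. (i, i)" fst]) (auto simp: power2_eq_square)
  finally show ?thesis by (simp add: E2_def)
qed

lemma E2_pos:
  fixes x :: "real ^ 'n::{finite, linorder}"
  assumes "CARD('n) \<ge> 2" "x \<in> positive_orthant"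
  shows "0 < E2 x"
proof -
  have "\<not> card (UNIV :: 'n set) \<le> Suc 0" using assms by simp
  then obtain a b :: 'n where "a \<noteq> b"
    by (metis (full_types) UNIV_I card_le_Suc0_iff_eq finite)
  then have "{(i :: 'n, j). i < j} \<noteq> {}"
    by (metis (mono_tags, lifting) case_prodI empty_iff mem_Collect_eq neqE)
  then show ?thesis
    unfolding E2_def using assms(2)
    by (intro sum_pos) (auto simp: positive_orthant_def)
qed

lemma E2_add_axis:
  fixes x :: "real ^ 'n::{finite, linorder}"
  shows "E2 (x + t *\<^sub>R axis i 1) = E2 x + t * ((\<Sum>j\<in>UNIV. x $ j) - x $ i)"
proof -
  have "(\<Sum>j\<in>UNIV. (axis i 1 :: real ^ 'n::{finite, linorder}) $ j) = 1"
    by (simp add: axis_def)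
  then have 1: "(\<Sum>j\<in>UNIV. (x + t *\<^sub>R axis i 1) $ j) = (\<Sum>j\<in>UNIV. x $ j) + t"
    by (simp add: sum.distrib flip: sum_distrib_left)
  have "((x + t *\<^sub>R axis i 1) $ j)\<^sup>2 = (x $ j)\<^sup>2 + (if j = i then 2 * t * x $ i + t\<^sup>2 else 0)" for j
    by (auto simp: axis_def power2_eq_square algebra_simps)
  then have 2: "(\<Sum>j\<in>UNIV. ((x + t *\<^sub>R axis i 1) $ j)\<^sup>2) = (\<Sum>j\<in>UNIV. (x $ j)\<^sup>2) + (2 * t * x $ i + t\<^sup>2)"
    by (simp add: sum.distrib)
  show ?thesis
    unfolding E2_eq 1 2 by (simp add: power2_eq_square field_simps)
qed

section \<open>Smoothness of the real powers of \<open>E2\<close>\<close>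

lemma E2_powr_has_derivative:
  fixes x :: "real ^ 'n::{finite, linorder}"
  assumes "CARD('n) \<ge> 2" "x \<in> positive_orthant"
  shows "((\<lambda>t. E2 (x + t *\<^sub>R axis i 1) powr \<gamma>) has_field_derivative
    \<gamma> * (E2 x powr (\<gamma> - 1) * ((\<Sum>j\<in>UNIV. x $ j) - x $ i))) (at 0)"
  unfolding E2_add_axis using E2_pos[OF assms]
  by (auto intro!: derivative_eq_intros)

text \<open>The algebra generated by the coordinates and all real powers of \<open>E2\<close>.
  Differentiation lowers an exponent by one and brings in coordinates, so the algebra is closed
  under it and serves as the family in \<open>C_infinity_onI\<close>.\<close>

inductive_set E2_functions :: "(real ^ 'n::{finite, linorder} \<Rightarrow> real) set" where
  const: "(\<lambda>x. c) \<in> E2_functions"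
| coordinate: "(\<lambda>x. x $ i) \<in> E2_functions"
| powr: "(\<lambda>x. E2 x powr \<gamma>) \<in> E2_functions"
| add: "f \<in> E2_functions \<Longrightarrow> g \<in> E2_functions \<Longrightarrow> (\<lambda>x. f x + g x) \<in> E2_functions"
| mult: "f \<in> E2_functions \<Longrightarrow> g \<in> E2_functions \<Longrightarrow> (\<lambda>x. f x * g x) \<in> E2_functions"

lemma E2_functions_sum:
  assumes "finite A" "\<And>a. a \<in> A \<Longrightarrow> f a \<in> E2_functions"
  shows "(\<lambda>x. \<Sum>a\<in>A. f a x) \<in> E2_functions"
  using assms by (induction A rule: finite_induct) (auto intro: E2_functions.intros)

lemma E2_functions_derivative:
  fixes f :: "real ^ 'n::{finite, linorder} \<Rightarrow> real"
  assumes "CARD('n) \<ge> 2" "f \<in> E2_functions"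
  shows "\<exists>f'\<in>E2_functions. \<forall>x\<in>positive_orthant.
    ((\<lambda>t. f (x + t *\<^sub>R axis i 1)) has_field_derivative f' x) (at 0)"
  using assms(2)
proof induction
  case (const c)
  then show ?case by (intro bexI[of _ "\<lambda>x. 0"]) (auto intro: E2_functions.const)
next
  case (coordinate j)
  then show ?case
    by (intro bexI[of _ "\<lambda>x. axis i 1 $ j"]) (auto intro: E2_functions.const intro!: derivative_eq_intros)
next
  case (powr \<gamma>)
  \<comment> \<open>The subtraction is written as a sum with the coefficient \<open>- 1\<close> so
    that the generating rules apply.\<close>
  have "(\<lambda>x :: real ^ 'n::{finite, linorder}. \<gamma> * (E2 x powr (\<gamma> - 1) * ((\<Sum>j\<in>UNIV. x $ j) + (- 1) * x $ i))) \<in> E2_functions"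
    by (intro E2_functions.intros E2_functions_sum finite)
  then show ?case
    using E2_powr_has_derivative[OF assms(1)] by (intro bexI) auto
next
  case (add f g)
  then obtain f' g' where "f' \<in> E2_functions" "g' \<in> E2_functions"
    "\<forall>x\<in>positive_orthant. ((\<lambda>t. f (x + t *\<^sub>R axis i 1)) has_field_derivative f' x) (at 0)"
    "\<forall>x\<in>positive_orthant. ((\<lambda>t. g (x + t *\<^sub>R axis i 1)) has_field_derivative g' x) (at 0)"
    by blast
  then show ?case
    by (intro bexI[of _ "\<lambda>x. f' x + g' x"]) (auto intro: E2_functions.add DERIV_add)
next
  case (mult f g)
  then obtain f' g' where *: "f' \<in> E2_functions" "g' \<in> E2_functions"
    "\<forall>x\<in>positive_orthant. ((\<lambda>t. f (x + t *\<^sub>R axis i 1)) has_field_derivative f' x) (at 0)"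
    "\<forall>x\<in>positive_orthant. ((\<lambda>t. g (x + t *\<^sub>R axis i 1)) has_field_derivative g' x) (at 0)"
    by blast
  then have "((\<lambda>t. f (x + t *\<^sub>R axis i 1) * g (x + t *\<^sub>R axis i 1)) has_field_derivative
      f' x * g x + g' x * f x) (at 0)" if "x \<in> positive_orthant" for x
    using DERIV_mult[of "\<lambda>t. f (x + t *\<^sub>R axis i 1)" "f' x" 0 UNIV "\<lambda>t. g (x + t *\<^sub>R axis i 1)" "g' x"]
      that by simp
  with * mult.hyps show ?case
    by (intro bexI[of _ "\<lambda>x. f' x * g x + g' x * f x"]) (auto intro: E2_functions.intros)
qed

lemma continuous_on_E2: "continuous_on S E2"
  unfolding E2_def case_prod_beta by (intro continuous_intros)

lemma C_infinity_on_E2_powr: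
  assumes "CARD('n::{finite, linorder}) \<ge> 2"
  shows "C_infinity_on positive_orthant (\<lambda>x :: real ^ 'n::{finite, linorder}. E2 x powr \<gamma>)"
proof (rule C_infinity_onI[where \<F> = E2_functions])
  fix g :: "real ^ 'n::{finite, linorder} \<Rightarrow> real" assume "g \<in> E2_functions"
  then show "continuous_on positive_orthant g"
  proof induction
    case (powr \<gamma>)
    show ?case
      by (intro continuous_on_powr continuous_on_E2 continuous_on_const) (use E2_pos[OF assms] in force)
  qed (auto intro!: continuous_intros)
qed (use E2_functions_derivative[OF assms] in \<open>auto intro: E2_functions.powr\<close>)

section \<open>Sufficiency of the bound on the exponent\<close>

lemma difference_monotone_E2_powr:
  assumes n: "CARD('n::{finite, linorder}) \<ge> 2"
    and \<beta>: "0 < \<beta>" "\<beta> \<ge> (real CARD('n::{finite, linorder}) - 2) / 2"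
  shows "difference_monotone (\<lambda>x :: real ^ 'n::{finite, linorder}. E2 x powr (- \<beta>))"
proof -
  \<comment> \<open>One variable \<open>j\<close> is singled out. The squares of the other
    \<open>n - 1\<close> become a multiple of the square of their sum plus \<open>n - 2\<close>
    squares of contrasts.\<close>
  define j :: 'n where "j = undefined"
  define A where "A = UNIV - {j}"
  have A: "card A = CARD('n) - 1" "finite A" by (auto simp: A_def)
  with n have "0 < card A" by simp
  then have "A \<noteq> {}" by auto
  then obtain ls :: "(real ^ 'n::{finite, linorder}) list" where ls: "length ls = card A - 1"
    "\<And>x. (\<Sum>i\<in>A. (x $ i)\<^sup>2) = (\<Sum>i\<in>A. x $ i)\<^sup>2 / card A + (\<Sum>l\<leftarrow>ls. (l \<bullet> x)\<^sup>2)"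
    using sum_squares_helmert[OF A(2)] by blast
  \<comment> \<open>With \<open>p \<bullet> x\<close> the sum over \<open>A\<close>,
    \<open>2 * E2 x\<close> is \<open>2 * x $ j * (p \<bullet> x) + (p \<bullet> x)\<^sup>2\<close>
    minus the squares over \<open>A\<close>. Removing the mean part of these squares leaves the
    coefficient \<open>1 - 1 / card A\<close>, which dictates \<open>r\<close>.\<close>
  define p :: "real ^ 'n::{finite, linorder}" where "p = (\<Sum>i\<in>A. axis i 1)"
  define r :: "real ^ 'n::{finite, linorder}" where "r = 2 *\<^sub>R axis j 1 + (1 - 1 / card A) *\<^sub>R p"
  have p: "p \<bullet> x = (\<Sum>i\<in>A. x $ i)" for x
    by (simp add: p_def inner_sum_left inner_axis')
  have p_nonneg: "0 \<le> p $ i" for i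
    by (simp add: p_def axis_def sum_nonneg)
  have r_nonneg: "0 \<le> r $ i" for i
    using \<open>0 < card A\<close> p_nonneg by (auto simp: r_def axis_def)
  have r: "r \<bullet> x = 2 * x $ j + (1 - 1 / card A) * (p \<bullet> x)" for x
    by (simp add: r_def inner_add_left inner_axis')
  have E2: "2 * E2 x = (r \<bullet> x) * (p \<bullet> x) - (\<Sum>l\<leftarrow>ls. (l \<bullet> x)\<^sup>2)" for x
  proof -
    have split: "(\<Sum>i\<in>UNIV. f i) = f j + (\<Sum>i\<in>A. f i)" for f :: "'n \<Rightarrow> real"
      unfolding A_def by (rule sum.remove) auto
    have "2 * E2 x = (x $ j + (\<Sum>i\<in>A. x $ i))\<^sup>2 - ((x $ j)\<^sup>2 + (\<Sum>i\<in>A. (x $ i)\<^sup>2))"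
      by (simp add: E2_eq split)
    then show ?thesis
      unfolding ls(2) r p by (simp add: power2_eq_square algebra_simps)
  qed
  obtain i where "i \<in> A" using \<open>A \<noteq> {}\<close> by blast
  then have "p \<bullet> axis i 1 = 1" using A by (simp add: p axis_def)
  then have "p \<noteq> 0" by auto
  \<comment> \<open>Since \<open>E2\<close> vanishes at the axis vectors, the coordinatewise
    condition on \<open>ls\<close> holds with equality.\<close>
  have axis: "E2 (axis i 1 :: real ^ 'n::{finite, linorder}) = 0" for i
    by (simp add: E2_eq axis_def if_distrib[of "\<lambda>x. x\<^sup>2"] cong: if_cong)
  have "difference_monotone (\<lambda>x. ((r \<bullet> x) * (p \<bullet> x) - (\<Sum>l\<leftarrow>ls. (l \<bullet> x)\<^sup>2)) powr (- \<beta>))"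
  proof (rule difference_monotone_powr_quadratic)
    show "(\<Sum>l\<leftarrow>ls. (l $ i)\<^sup>2) \<le> r $ i * p $ i" for i
      using E2[of "axis i 1"] by (simp add: axis inner_axis)
    show "(\<Sum>l\<leftarrow>ls. (l \<bullet> x)\<^sup>2) < (r \<bullet> x) * (p \<bullet> x)" if "x \<in> positive_orthant" for x
      using E2[of x] E2_pos[OF n that] by linarith
    show "real (length ls) / 2 \<le> \<beta>"
      using \<beta> n by (simp add: ls A)
  qed (use \<beta> p_nonneg r_nonneg \<open>p \<noteq> 0\<close> in auto)
  then have "difference_monotone (\<lambda>x :: real ^ 'n::{finite, linorder}. 2 powr \<beta> * (2 * E2 x) powr (- \<beta>))"
    unfolding E2 by (intro difference_monotone_cmult) auto
  then show ?thesis
    by (rule difference_monotone_cong)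
      (use E2_pos[OF n] in \<open>simp add: powr_mult powr_minus less_imp_le\<close>)
qed

section \<open>Squares of quadratic forms in the derivatives\<close>

text \<open>The operators \<open>(1 + D) / 2\<close> and \<open>(1 - D) / 2\<close> sum to the identity. Expanding the
  identity binomially in them \<open>N\<close> times, as in the proof that Bernstein polynomials converge,
  weights \<open>(number of plus signs - number of minus signs)\<^sup>2\<close> nonnegatively and yields
  \<open>N + N (N - 1) D\<^sup>2\<close>; the parameter \<open>u\<close> only serves the induction.\<close>

lemma difference_monotone_square_nonneg:
  fixes D :: "(real ^ 'n \<Rightarrow> real) \<Rightarrow> real ^ 'n \<Rightarrow> real"
  assumes linear: "\<And>a b f g. D (\<lambda>x. a * f x + b * g x) = (\<lambda>x. a * D f x + b * D g x)"
    and plus: "\<And>f. difference_monotone f \<Longrightarrow> difference_monotone (\<lambda>x. f x + D f x)"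
    and minus: "\<And>f. difference_monotone f \<Longrightarrow> difference_monotone (\<lambda>x. f x - D f x)"
    and f: "difference_monotone f" and x: "x \<in> positive_orthant"
  shows "0 \<le> D (D f) x"
proof -
  have main: "0 \<le> u\<^sup>2 * f x + 2 * u * real N * D f x + real N * f x + real N * (real N - 1) * D (D f) x"
    if "difference_monotone f" for f u N
    using that
  proof (induction N arbitrary: f u)
    case 0
    then show ?case using difference_monotone_nonneg[OF _ x] by simp
  next
    case (Suc N)
    \<comment> \<open>\<open>u\<close> records the signs chosen so far: it moves by
      \<open>+ 1\<close> along \<open>a\<close> and by \<open>- 1\<close> along
      \<open>b\<close>.\<close>
    define a b where "a = (\<lambda>x. (1 / 2) * f x + (1 / 2) * D f x)"
      and "b = (\<lambda>x. (1 / 2) * f x + (- 1 / 2) * D f x)"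
    have a: "difference_monotone a"
      using difference_monotone_cmult[OF _ plus[OF Suc.prems], of "1 / 2"]
      by (simp add: a_def field_simps)
    have b: "difference_monotone b"
      using difference_monotone_cmult[OF _ minus[OF Suc.prems], of "1 / 2"]
      by (simp add: b_def field_simps)
    have D: "D a = (\<lambda>x. (1 / 2) * D f x + (1 / 2) * D (D f) x)"
      "D b = (\<lambda>x. (1 / 2) * D f x + (- 1 / 2) * D (D f) x)"
      "D (D a) = (\<lambda>x. (1 / 2) * D (D f) x + (1 / 2) * D (D (D f)) x)"
      "D (D b) = (\<lambda>x. (1 / 2) * D (D f) x + (- 1 / 2) * D (D (D f)) x)"
      unfolding a_def b_def linear by (rule refl)+
    have "0 \<le> ((u + 1)\<^sup>2 * a x + 2 * (u + 1) * real N * D a x + real N * a x +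
          real N * (real N - 1) * D (D a) x) +
        ((u - 1)\<^sup>2 * b x + 2 * (u - 1) * real N * D b x + real N * b x +
          real N * (real N - 1) * D (D b) x)"
      by (intro add_nonneg_nonneg Suc.IH a b)
    also have "\<dots> = u\<^sup>2 * f x + 2 * u * real (Suc N) * D f x + real (Suc N) * f x +
        real (Suc N) * (real (Suc N) - 1) * D (D f) x"
      unfolding D(3,4) unfolding D(1,2)
      by (simp add: a_def b_def power2_eq_square field_simps)
    finally show ?case .
  qed
  show ?thesis
  proof (rule ccontr)
    assume "\<not> ?thesis"
    then have neg: "D (D f) x < 0" by simp
    obtain N where N: "f x / (- D (D f) x) < real N" using reals_Archimedean2 by blast
    have "0 \<le> real (Suc N) * (f x + real N * D (D f) x)"
      using main[OF f, of 0 "Suc N"] by (simp add: algebra_simps)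
    then have "0 \<le> f x + real N * D (D f) x"
      by (simp add: zero_le_mult_iff)
    with N neg show False by (simp add: field_simps)
  qed
qed

section \<open>Difference operators of second order\<close>

lemma difference_monotone_add_second_drop:
  assumes f: "difference_monotone f" and h: "0 \<le> h" and s: "s \<in> {1, - 1}"
  shows "difference_monotone (\<lambda>x. f x + s * forward_drop i h (forward_drop j h f) x)"
proof (cases "s = 1")
  case True
  then show ?thesis
    using f h by (auto intro: difference_monotone_add difference_monotone_forward_drop)
next
  case False
  \<comment> \<open>Writing \<open>f\<close> as its shift along \<open>i\<close> plus its drop along
    \<open>i\<close> turns \<open>f\<close> minus the double drop into a shift of \<open>f\<close>
    plus a drop of another shift.\<close>
  have "difference_monotone (\<lambda>x. f (x + h *\<^sub>R axis i 1) +
      forward_drop i h (\<lambda>x. f (x + h *\<^sub>R axis j 1)) x)"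
    by (intro difference_monotone_add difference_monotone_shift difference_monotone_forward_drop f h)
  moreover have "f (x + h *\<^sub>R axis i 1) + forward_drop i h (\<lambda>x. f (x + h *\<^sub>R axis j 1)) x =
      f x + s * forward_drop i h (forward_drop j h f) x" for x
    using False s by (simp add: forward_drop_def algebra_simps)
  ultimately show ?thesis by simp
qed

definition quadratic_drop ::
  "('n \<times> 'n \<Rightarrow> real) \<Rightarrow> real \<Rightarrow> (real ^ 'n \<Rightarrow> real) \<Rightarrow> real ^ 'n \<Rightarrow> real" where
  "quadratic_drop q h f x = (\<Sum>p\<in>UNIV. q p * forward_drop (fst p) h (forward_drop (snd p) h f) x)"

text \<open>A convex combination: \<open>f\<close> has the weight
  \<open>1 - (\<Sum>p\<in>UNIV. \<bar>q p\<bar>)\<close>, and \<open>f\<close> plus or minus the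
  double drop for \<open>p\<close>, with the sign of \<open>q p\<close>, has the weight
  \<open>\<bar>q p\<bar>\<close>.\<close>

lemma difference_monotone_add_quadratic_drop:
  assumes f: "difference_monotone f" and h: "0 \<le> h" and q: "(\<Sum>p\<in>UNIV. \<bar>q p\<bar>) \<le> 1"
  shows "difference_monotone (\<lambda>x. f x + quadratic_drop q h f x)"
proof -
  define s where "s p = (if 0 \<le> q p then 1 else - 1 :: real)" for p
  have "difference_monotone (\<lambda>x. (1 - (\<Sum>p\<in>UNIV. \<bar>q p\<bar>)) * f x +
      (\<Sum>p\<in>UNIV. \<bar>q p\<bar> * (f x + s p * forward_drop (fst p) h (forward_drop (snd p) h f) x)))"
    using q by (intro difference_monotone_add difference_monotone_cmult difference_monotone_sum
        difference_monotone_add_second_drop f h) (auto simp: s_def)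
  moreover have "(1 - (\<Sum>p\<in>UNIV. \<bar>q p\<bar>)) * f x +
      (\<Sum>p\<in>UNIV. \<bar>q p\<bar> * (f x + s p * forward_drop (fst p) h (forward_drop (snd p) h f) x)) =
      f x + quadratic_drop q h f x" for x
  proof -
    have *: "\<bar>q p\<bar> * (f x + s p * y) = \<bar>q p\<bar> * f x + q p * y" for p y
      by (simp add: s_def algebra_simps)
    then show ?thesis
      by (simp add: quadratic_drop_def * sum.distrib left_diff_distrib flip: sum_distrib_right)
  qed
  ultimately show ?thesis by simp
qed

lemma quadratic_drop_linear:
  "quadratic_drop q h (\<lambda>x. a * f x + b * g x) =
    (\<lambda>x. a * quadratic_drop q h f x + b * quadratic_drop q h g x)"
  unfolding quadratic_drop_def forward_drop_def fun_eq_iff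
  by (simp add: sum_distrib_left sum.distrib[symmetric] algebra_simps)

text \<open>The claim is homogeneous in \<open>q\<close>, so the coefficients may be scaled to total
  weight at most one. Then adding or subtracting the operator preserves the class, and
  \<open>difference_monotone_square_nonneg\<close> applies.\<close>

lemma quadratic_drop_square_nonneg:
  assumes f: "difference_monotone f" and x: "x \<in> positive_orthant" and h: "0 \<le> h"
  shows "0 \<le> quadratic_drop q h (quadratic_drop q h f) x"
proof -
  \<comment> \<open>The summand \<open>1\<close> keeps \<open>K\<close> positive when all
    coefficients vanish.\<close>
  define K where "K = (\<Sum>p\<in>UNIV. \<bar>q p\<bar>) + 1"
  have K: "0 < K" by (simp add: K_def add_nonneg_pos sum_nonneg)
  define c where "c p = q p / K" for p
  have drop_c: "quadratic_drop c h f = (\<lambda>x. quadratic_drop q h f x / K)" for f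
    by (simp add: quadratic_drop_def c_def sum_divide_distrib fun_eq_iff)
  have drop_uminus: "quadratic_drop (\<lambda>p. - c p) h f = (\<lambda>x. - quadratic_drop c h f x)" for f
    by (simp add: quadratic_drop_def sum_negf fun_eq_iff)
  have c: "(\<Sum>p\<in>UNIV. \<bar>c p\<bar>) \<le> 1"
    using K by (simp add: c_def abs_divide flip: sum_divide_distrib) (simp add: K_def)
  have "0 \<le> quadratic_drop c h (quadratic_drop c h f) x"
  proof (rule difference_monotone_square_nonneg[OF quadratic_drop_linear _ _ f x])
    fix f :: "real ^ 'a \<Rightarrow> real" assume f: "difference_monotone f"
    show "difference_monotone (\<lambda>x. f x + quadratic_drop c h f x)"
      by (rule difference_monotone_add_quadratic_drop[OF f h c])
    show "difference_monotone (\<lambda>x. f x - quadratic_drop c h f x)"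
      using difference_monotone_add_quadratic_drop[OF f h, of "\<lambda>p. - c p"] c
      by (simp add: drop_uminus)
  qed
  also have "quadratic_drop c h (quadratic_drop c h f) x =
      quadratic_drop q h (quadratic_drop q h f) x / K\<^sup>2"
    using quadratic_drop_linear[of q h "1 / K" "quadratic_drop q h f" 0 f]
    by (simp add: drop_c power2_eq_square)
  finally show ?thesis using K by (simp add: zero_le_divide_iff)
qed

text \<open>Divide the squared difference operator by \<open>h ^ 4\<close> and let \<open>h\<close>
  tend to \<open>0\<close>; the sign of four drops is positive.\<close>

lemma quadratic_partial_square_nonneg:
  assumes f: "difference_monotone f" and smooth: "C_infinity_on positive_orthant f"
    and x: "x \<in> positive_orthant"
  shows "0 \<le> (\<Sum>p\<in>UNIV. q p * (\<Sum>p'\<in>UNIV. q p' * iter_partial [snd p, fst p, snd p', fst p'] f x))"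
proof -
  have "quadratic_drop q h (quadratic_drop q h f) x = (\<Sum>p'\<in>UNIV. q p' * (\<Sum>p\<in>UNIV. q p *
      iter_drop (map (\<lambda>i. (i, h)) [snd p, fst p, snd p', fst p']) f x))" for h
    unfolding quadratic_drop_def by (simp add: quadratic_drop_def[abs_def] forward_drop_sum)
  \<comment> \<open>\<open>iter_drop\<close> applies the head of its list first,
    \<open>iter_partial\<close> applies it last. Exchanging the sums matches the order of the
    derivatives.\<close>
  also have "\<dots> h = (\<Sum>p\<in>UNIV. q p * (\<Sum>p'\<in>UNIV. q p' *
      iter_drop (map (\<lambda>i. (i, h)) [snd p, fst p, snd p', fst p']) f x))" for h
    unfolding sum_distrib_left by (subst sum.swap) (simp add: mult_ac)
  finally have eq: "quadratic_drop q h (quadratic_drop q h f) x / h ^ 4 =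
      (\<Sum>p\<in>UNIV. q p * (\<Sum>p'\<in>UNIV. q p' *
      (iter_drop (map (\<lambda>i. (i, h)) [snd p, fst p, snd p', fst p']) f x / h ^ 4)))" for h
    by (simp only: sum_divide_distrib times_divide_eq_right[symmetric])
  have "((\<lambda>h. iter_drop (map (\<lambda>i. (i, h)) [snd p, fst p, snd p', fst p']) f x / h ^ 4) \<longlongrightarrow>
      iter_partial [snd p, fst p, snd p', fst p'] f x) (at_right 0)" for p p'
    using iter_drop_quotient_tendsto[OF smooth x, of "[snd p, fst p, snd p', fst p']"]
    by (simp add: numeral_eq_Suc)
  then have "((\<lambda>h. quadratic_drop q h (quadratic_drop q h f) x / h ^ 4) \<longlongrightarrow>
      (\<Sum>p\<in>UNIV. q p * (\<Sum>p'\<in>UNIV. q p' * iter_partial [snd p, fst p, snd p', fst p'] f x)))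
      (at_right 0)"
    unfolding eq by (intro tendsto_sum tendsto_mult_left)
  moreover have "\<forall>\<^sub>F h in at_right 0. 0 \<le> quadratic_drop q h (quadratic_drop q h f) x / h ^ 4"
    using eventually_at_right_less[of 0]
    by (auto elim!: eventually_mono intro!: divide_nonneg_nonneg quadratic_drop_square_nonneg[OF f x])
  ultimately show ?thesis
    by (rule tendsto_lowerbound) simp
qed

section \<open>The dual form and necessity\<close>

lemma E2_powr_partial:
  fixes x :: "real ^ 'n::{finite, linorder}"
  assumes "CARD('n) \<ge> 2" "x \<in> positive_orthant"
  shows "iter_partial [i] (\<lambda>x. E2 x powr \<gamma>) x = \<gamma> * (E2 x powr (\<gamma> - 1) * ((\<Sum>k\<in>UNIV. x $ k) - x $ i))"
  using partial_deriv_eq[OF E2_powr_has_derivative[OF assms]]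
  by (simp add: iter_partial_Cons iter_partial_Nil)

lemma E2_powr_second_partial:
  fixes x :: "real ^ 'n::{finite, linorder}"
  assumes n: "CARD('n) \<ge> 2" and x: "x \<in> positive_orthant"
  shows "iter_partial [j, i] (\<lambda>x. E2 x powr \<gamma>) x =
    \<gamma> * (\<gamma> - 1) * E2 x powr (\<gamma> - 2) * (((\<Sum>k\<in>UNIV. x $ k) - x $ i) * ((\<Sum>k\<in>UNIV. x $ k) - x $ j)) +
    \<gamma> * E2 x powr (\<gamma> - 1) * (if i = j then 0 else 1)"
proof -
  have "(\<Sum>k\<in>UNIV. (axis j 1 :: real ^ 'n::{finite, linorder}) $ k) = 1"
    by (simp add: axis_def)
  then have coord: "(\<Sum>k\<in>UNIV. (x + t *\<^sub>R axis j 1) $ k) - (x + t *\<^sub>R axis j 1) $ i =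
      ((\<Sum>k\<in>UNIV. x $ k) - x $ i) + t * (if i = j then 0 else 1)" for t
    by (simp add: sum.distrib flip: sum_distrib_left) (simp add: axis_def)
  have "((\<lambda>t. ((\<Sum>k\<in>UNIV. x $ k) - x $ i) + t * (if i = j then 0 else 1)) has_field_derivative
      (if i = j then 0 else 1)) (at 0)"
    by (auto intro!: derivative_eq_intros)
  from DERIV_cmult[OF DERIV_mult[OF E2_powr_has_derivative[OF n x, of j "\<gamma> - 1"] this], of \<gamma>]
  have "((\<lambda>t. \<gamma> * (E2 (x + t *\<^sub>R axis j 1) powr (\<gamma> - 1) *
      ((\<Sum>k\<in>UNIV. (x + t *\<^sub>R axis j 1) $ k) - (x + t *\<^sub>R axis j 1) $ i))) has_field_derivative
      \<gamma> * ((\<gamma> - 1) * (E2 x powr (\<gamma> - 2) * ((\<Sum>k\<in>UNIV. x $ k) - x $ j)) * ((\<Sum>k\<in>UNIV. x $ k) - x $ i) +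
        E2 x powr (\<gamma> - 1) * (if i = j then 0 else 1))) (at 0)"
    unfolding coord by (simp add: mult_ac)
  note partial_deriv_eq[where f = "\<lambda>x. \<gamma> * (E2 x powr (\<gamma> - 1) * ((\<Sum>k\<in>UNIV. x $ k) - x $ i))", OF this]
  moreover have "iter_partial [j, i] (\<lambda>x. E2 x powr \<gamma>) x =
      partial_deriv j (\<lambda>x. \<gamma> * (E2 x powr (\<gamma> - 1) * ((\<Sum>k\<in>UNIV. x $ k) - x $ i))) x"
    unfolding iter_partial_Cons[of j] by (rule partial_deriv_cong[OF E2_powr_partial[OF n] x])
  ultimately show ?thesis by (simp add: algebra_simps)
qed

text \<open>Up to a factor, the quadratic form dual to the restriction of \<open>E2\<close> to the variables
  indexed by \<open>J\<close>.\<close>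

definition dual_form :: "'n set \<Rightarrow> 'n \<times> 'n \<Rightarrow> real" where
  "dual_form J p = (if p \<in> J \<times> J then 1 / (real (card J) - 1) - (if fst p = snd p then 1 else 0) else 0)"

lemma sum_dual_form:
  fixes J :: "'n::finite set"
  shows "(\<Sum>p\<in>UNIV. dual_form J p * g p) =
    (\<Sum>i\<in>J. \<Sum>j\<in>J. g (i, j)) / (real (card J) - 1) - (\<Sum>i\<in>J. g (i, i))"
proof -
  have "(\<Sum>p\<in>UNIV. dual_form J p * g p) =
      (\<Sum>p\<in>J \<times> J. (1 / (real (card J) - 1) - (if fst p = snd p then 1 else 0)) * g p)"
    by (rule sum.mono_neutral_cong_right) (auto simp: dual_form_def)
  also have "\<dots> = (\<Sum>i\<in>J. \<Sum>j\<in>J. g (i, j) / (real (card J) - 1) - (if i = j then g (i, j) else 0))"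
    unfolding sum.cartesian_product by (intro sum.cong) (auto simp: left_diff_distrib)
  also have "\<dots> = (\<Sum>i\<in>J. \<Sum>j\<in>J. g (i, j)) / (real (card J) - 1) - (\<Sum>i\<in>J. g (i, i))"
    by (simp add: sum_subtractf sum_divide_distrib)
  finally show ?thesis .
qed

lemma sum_dual_form_product:
  fixes J :: "'n::finite set"
  shows "(\<Sum>p\<in>UNIV. dual_form J p * (a (fst p) * a (snd p))) =
    (\<Sum>i\<in>J. a i)\<^sup>2 / (real (card J) - 1) - (\<Sum>i\<in>J. (a i)\<^sup>2)"
  by (simp add: sum_dual_form power2_eq_square sum_product)

text \<open>The trace of a product of inverse matrices: on \<open>J\<close>,
  \<open>dual_form J\<close> inverts the Hessian of \<open>E2\<close>, which is \<open>0\<close> on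
  the diagonal and \<open>1\<close> off it.\<close>

lemma sum_dual_form_off_diagonal:
  fixes J :: "'n::finite set"
  assumes "2 \<le> card J"
  shows "(\<Sum>p\<in>UNIV. dual_form J p * (if fst p = snd p then 0 else 1)) = real (card J)"
proof -
  have "(\<Sum>j\<in>J. if i = j then 0 else 1 :: real) = real (card J) - 1" if "i \<in> J" for i
  proof -
    have "(\<Sum>j\<in>J. if i = j then 0 else 1 :: real) = (\<Sum>j\<in>J. 1 - (if i = j then 1 else 0))"
      by (intro sum.cong) auto
    then show ?thesis using that by (simp add: sum_subtractf)
  qed
  then show ?thesis using assms by (simp add: sum_dual_form)
qed

text \<open>The contribution of the variables outside \<open>J\<close> to Cayley's identity below. It is constant
  in the variables indexed by \<open>J\<close>, so it acts as a scalar when the identity is applied twice.\<close>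

definition outer_part :: "'n set \<Rightarrow> real ^ 'n \<Rightarrow> real" where
  "outer_part J x = (\<Sum>i\<in>- J. x $ i)\<^sup>2 / (real (card J) - 1) + (\<Sum>i\<in>- J. (x $ i)\<^sup>2)"

text \<open>A form of Cayley's identity: the dual quadratic form in the derivatives lowers the
  exponent of \<open>E2\<close>.\<close>

lemma E2_powr_dual_form:
  fixes x :: "real ^ 'n::{finite, linorder}"
  assumes n: "CARD('n) \<ge> 2" and x: "x \<in> positive_orthant" and J: "2 \<le> card J"
  shows "(\<Sum>p\<in>UNIV. dual_form J p * iter_partial [snd p, fst p] (\<lambda>x. E2 x powr \<gamma>) x) =
    \<gamma> * (2 * \<gamma> - 2 + real (card J)) * E2 x powr (\<gamma> - 1) +
    \<gamma> * (\<gamma> - 1) * (outer_part J x * E2 x powr (\<gamma> - 2))"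
proof -
  define S m where "S = (\<Sum>k\<in>UNIV. x $ k)" and "m = real (card J)"
  define R T where "R = (\<Sum>i\<in>- J. x $ i)" and "T = (\<Sum>i\<in>- J. (x $ i)\<^sup>2)"
  have m: "1 < m" using J by (simp add: m_def)
  have split: "(\<Sum>i\<in>UNIV. f i) = (\<Sum>i\<in>J. f i) + (\<Sum>i\<in>- J. f i)" for f :: "'n \<Rightarrow> real"
    by (subst sum.union_disjoint[symmetric]) auto
  have lin: "(\<Sum>i\<in>J. x $ i) = S - R" unfolding S_def R_def split by simp
  have quad: "(\<Sum>i\<in>J. (x $ i)\<^sup>2) = S\<^sup>2 - 2 * E2 x - T" unfolding S_def T_def E2_eq split by (simp add: field_simps)
  \<comment> \<open>The gradient of \<open>E2\<close> has the entries \<open>S - x $ i\<close>. For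
    \<open>J = UNIV\<close> it is the Hessian applied to \<open>x\<close>, so the dual form returns
    \<open>2 * E2 x\<close>; in general the other variables add
    \<open>outer_part J x\<close>.\<close>
  have "(\<Sum>p\<in>UNIV. dual_form J p * ((S - x $ fst p) * (S - x $ snd p))) =
      (\<Sum>i\<in>J. S - x $ i)\<^sup>2 / (m - 1) - (\<Sum>i\<in>J. (S - x $ i)\<^sup>2)"
    unfolding m_def by (rule sum_dual_form_product)
  also have "(\<Sum>i\<in>J. S - x $ i) = m * S - (S - R)"
    by (simp add: sum_subtractf m_def lin)
  also have "(\<Sum>i\<in>J. (S - x $ i)\<^sup>2) = m * S\<^sup>2 - 2 * S * (S - R) + (S\<^sup>2 - 2 * E2 x - T)"
    by (simp add: power2_diff sum_subtractf sum.distrib m_def lin quad flip: sum_distrib_left)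
  also have "(m * S - (S - R))\<^sup>2 / (m - 1) - (m * S\<^sup>2 - 2 * S * (S - R) + (S\<^sup>2 - 2 * E2 x - T)) =
      2 * E2 x + outer_part J x"
    using m by (simp add: outer_part_def flip: R_def T_def m_def)
      (simp add: field_simps power2_eq_square)
  finally have form: "(\<Sum>p\<in>UNIV. dual_form J p * ((S - x $ fst p) * (S - x $ snd p))) =
      2 * E2 x + outer_part J x" .
  have "(\<Sum>p\<in>UNIV. dual_form J p * iter_partial [snd p, fst p] (\<lambda>x. E2 x powr \<gamma>) x) =
      \<gamma> * (\<gamma> - 1) * E2 x powr (\<gamma> - 2) * (\<Sum>p\<in>UNIV. dual_form J p * ((S - x $ fst p) * (S - x $ snd p))) +
      \<gamma> * E2 x powr (\<gamma> - 1) * (\<Sum>p\<in>UNIV. dual_form J p * (if fst p = snd p then 0 else 1))"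
    unfolding E2_powr_second_partial[OF n x] sum_distrib_left sum.distrib[symmetric] S_def
    by (intro sum.cong) (auto simp: algebra_simps)
  also have "\<dots> = \<gamma> * (\<gamma> - 1) * E2 x powr (\<gamma> - 2) * (2 * E2 x + outer_part J x) +
      \<gamma> * E2 x powr (\<gamma> - 1) * m"
    unfolding form sum_dual_form_off_diagonal[OF J] m_def ..
  finally show ?thesis
    using E2_pos[OF n x] powr_add[of "E2 x" "\<gamma> - 2" 1] by (simp add: m_def algebra_simps)
qed

lemma outer_part_shift:
  assumes "i \<in> J"
  shows "outer_part J (x + t *\<^sub>R axis i 1) = outer_part J x"
proof -
  have *: "(x + t *\<^sub>R axis i 1) $ k = x $ k" if "k \<in> - J" for k
    using that assms by (auto simp: axis_def)
  show ?thesis unfolding outer_part_def by (simp only: * cong: sum.cong)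
qed

lemma partial_deriv_outer_part_combination:
  assumes "C_infinity_on positive_orthant f" "C_infinity_on positive_orthant g"
    and "i \<in> J" "x \<in> positive_orthant"
  shows "partial_deriv i (\<lambda>x. a * iter_partial is f x + b * (outer_part J x * iter_partial is g x)) x =
    a * iter_partial (i # is) f x + b * (outer_part J x * iter_partial (i # is) g x)"
  by (rule partial_deriv_eq, unfold outer_part_shift[OF assms(3)])
    (intro DERIV_add DERIV_cmult C_infinity_on_differentiable assms)

lemma iter_partial_outer_part_combination:
  assumes f: "C_infinity_on positive_orthant f" and g: "C_infinity_on positive_orthant g"
    and ij: "i \<in> J" "j \<in> J" and x: "x \<in> positive_orthant"
  shows "iter_partial [j, i] (\<lambda>x. a * f x + b * (outer_part J x * g x)) x =
    a * iter_partial [j, i] f x + b * (outer_part J x * iter_partial [j, i] g x)"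
proof -
  have "iter_partial [j, i] (\<lambda>x. a * f x + b * (outer_part J x * g x)) x =
      partial_deriv j (\<lambda>x. a * iter_partial [i] f x + b * (outer_part J x * iter_partial [i] g x)) x"
    unfolding iter_partial_Cons[of j]
    using partial_deriv_outer_part_combination[OF f g ij(1), of _ a "[]" b] x
    by (intro partial_deriv_cong) (simp_all add: iter_partial_Cons iter_partial_Nil)
  also have "\<dots> = a * iter_partial [j, i] f x + b * (outer_part J x * iter_partial [j, i] g x)"
    by (rule partial_deriv_outer_part_combination[OF f g ij(2) x])
  finally show ?thesis .
qed

lemma partial_deriv_sum:
  assumes "\<And>p. p \<in> P \<Longrightarrow> C_infinity_on positive_orthant (f p)" and "x \<in> positive_orthant"
  shows "partial_deriv i (\<lambda>x. \<Sum>p\<in>P. c p * iter_partial (is p) (f p) x) x =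
    (\<Sum>p\<in>P. c p * iter_partial (i # is p) (f p) x)"
  by (rule partial_deriv_eq) (intro DERIV_sum DERIV_cmult C_infinity_on_differentiable assms)

text \<open>Apply \<open>E2_powr_dual_form\<close> at the exponent \<open>\<gamma>\<close>, then at
  \<open>\<gamma> - 1\<close> and \<open>\<gamma> - 2\<close>. Coefficients vanish unless both
  indices lie in \<open>J\<close>, and derivatives in such variables treat
  \<open>outer_part J x\<close> as a constant.\<close>

lemma E2_powr_dual_form_square:
  fixes x :: "real ^ 'n::{finite, linorder}"
  assumes n: "CARD('n) \<ge> 2" and x: "x \<in> positive_orthant" and J: "2 \<le> card J"
  shows "(\<Sum>p\<in>UNIV. dual_form J p * (\<Sum>p'\<in>UNIV. dual_form J p' *
      iter_partial [snd p, fst p, snd p', fst p'] (\<lambda>x. E2 x powr \<gamma>) x)) =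
    \<gamma> * (2 * \<gamma> - 2 + real (card J)) *
      ((\<gamma> - 1) * (2 * \<gamma> - 4 + real (card J)) * E2 x powr (\<gamma> - 2) +
       (\<gamma> - 1) * (\<gamma> - 2) * (outer_part J x * E2 x powr (\<gamma> - 3))) +
    \<gamma> * (\<gamma> - 1) * (outer_part J x *
      ((\<gamma> - 2) * (2 * \<gamma> - 6 + real (card J)) * E2 x powr (\<gamma> - 3) +
       (\<gamma> - 2) * (\<gamma> - 3) * (outer_part J x * E2 x powr (\<gamma> - 4))))"
proof -
  let ?E = "\<lambda>\<gamma> x :: real ^ 'n::{finite, linorder}. E2 x powr \<gamma>"
  note smooth = C_infinity_on_E2_powr[OF n]
  define a b where "a = \<gamma> * (2 * \<gamma> - 2 + real (card J))" and "b = \<gamma> * (\<gamma> - 1)"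
  have inner: "(\<Sum>p'\<in>UNIV. dual_form J p' * iter_partial [snd p, fst p, snd p', fst p'] (?E \<gamma>) x) =
      a * iter_partial [snd p, fst p] (?E (\<gamma> - 1)) x +
      b * (outer_part J x * iter_partial [snd p, fst p] (?E (\<gamma> - 2)) x)" if p: "p \<in> J \<times> J" for p
  proof -
    let ?g = "\<lambda>x. \<Sum>p'\<in>UNIV. dual_form J p' * iter_partial [snd p', fst p'] (?E \<gamma>) x"
    have "(\<Sum>p'\<in>UNIV. dual_form J p' * iter_partial [snd p, fst p, snd p', fst p'] (?E \<gamma>) x) =
        partial_deriv (snd p) (\<lambda>x. \<Sum>p'\<in>UNIV. dual_form J p' * iter_partial [fst p, snd p', fst p'] (?E \<gamma>) x) x"
      by (rule partial_deriv_sum[symmetric, OF smooth x])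
    also have "\<dots> = iter_partial [snd p, fst p] ?g x"
      unfolding iter_partial_Cons[of "snd p" "[fst p]"] iter_partial_Cons[of "fst p" "[]"] iter_partial_Nil
      by (intro partial_deriv_cong x partial_deriv_sum[symmetric] smooth)
    also have "\<dots> = iter_partial [snd p, fst p]
        (\<lambda>x. a * ?E (\<gamma> - 1) x + b * (outer_part J x * ?E (\<gamma> - 2) x)) x"
      unfolding iter_partial_Cons iter_partial_Nil
      by (intro partial_deriv_cong x)
        (use E2_powr_dual_form[OF n _ J, of _ \<gamma>] in \<open>simp add: a_def b_def iter_partial_Cons iter_partial_Nil\<close>)
    also have "\<dots> = a * iter_partial [snd p, fst p] (?E (\<gamma> - 1)) x +
        b * (outer_part J x * iter_partial [snd p, fst p] (?E (\<gamma> - 2)) x)"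
      using p by (intro iter_partial_outer_part_combination smooth x) auto
    finally show ?thesis .
  qed
  have "(\<Sum>p\<in>UNIV. dual_form J p * (\<Sum>p'\<in>UNIV. dual_form J p' *
      iter_partial [snd p, fst p, snd p', fst p'] (?E \<gamma>) x)) =
    (\<Sum>p\<in>UNIV. dual_form J p * (a * iter_partial [snd p, fst p] (?E (\<gamma> - 1)) x +
      b * (outer_part J x * iter_partial [snd p, fst p] (?E (\<gamma> - 2)) x)))"
  proof (rule sum.cong)
    fix p :: "'n \<times> 'n"
    show "dual_form J p * (\<Sum>p'\<in>UNIV. dual_form J p' *
        iter_partial [snd p, fst p, snd p', fst p'] (?E \<gamma>) x) =
      dual_form J p * (a * iter_partial [snd p, fst p] (?E (\<gamma> - 1)) x +
        b * (outer_part J x * iter_partial [snd p, fst p] (?E (\<gamma> - 2)) x))"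
    proof (cases "p \<in> J \<times> J")
      case True
      then show ?thesis by (simp only: inner)
    qed (simp only: dual_form_def if_False mult_zero_left)
  qed simp
  also have "\<dots> = a * (\<Sum>p\<in>UNIV. dual_form J p * iter_partial [snd p, fst p] (?E (\<gamma> - 1)) x) +
      b * (outer_part J x * (\<Sum>p\<in>UNIV. dual_form J p * iter_partial [snd p, fst p] (?E (\<gamma> - 2)) x))"
    unfolding sum_distrib_left sum.distrib[symmetric] by (intro sum.cong) (auto simp: algebra_simps)
  finally show ?thesis
    unfolding E2_powr_dual_form[OF n x J] a_def b_def by (simp add: algebra_simps)
qed

section \<open>Exponents at which the sign condition fails\<close>

lemma not_difference_monotone_E2_powr_pos:
  assumes n: "CARD('n::{finite, linorder}) \<ge> 2" and "0 < \<gamma>"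
  shows "\<not> difference_monotone (\<lambda>x :: real ^ 'n::{finite, linorder}. E2 x powr \<gamma>)"
proof
  assume dm: "difference_monotone (\<lambda>x :: real ^ 'n::{finite, linorder}. E2 x powr \<gamma>)"
  define x :: "real ^ 'n::{finite, linorder}" where "x = (\<chi> i. 1)"
  define i :: 'n where "i = undefined"
  have x: "x \<in> positive_orthant" by (simp add: x_def positive_orthant_def)
  \<comment> \<open>\<open>E2\<close> increases along the axis, so its positive power has a negative
    drop.\<close>
  have "E2 x < E2 (x + 1 *\<^sub>R axis i 1)"
    unfolding E2_add_axis using n by (simp add: x_def)
  then have "E2 x powr \<gamma> < E2 (x + 1 *\<^sub>R axis i 1) powr \<gamma>"
    using E2_pos[OF n x] \<open>0 < \<gamma>\<close> by (intro powr_less_mono2) auto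
  moreover have "0 \<le> forward_drop i 1 (\<lambda>x. E2 x powr \<gamma>) x"
    by (rule difference_monotone_nonneg[OF difference_monotone_forward_drop[OF dm] x]) simp
  ultimately show False by (simp add: forward_drop_def)
qed

lemma not_difference_monotone_E2_powr_neg:
  assumes n: "CARD('n::{finite, linorder}) \<ge> 2"
    and \<beta>: "0 < \<beta>" "\<beta> < (real CARD('n::{finite, linorder}) - 2) / 2"
  shows "\<not> difference_monotone (\<lambda>x :: real ^ 'n::{finite, linorder}. E2 x powr (- \<beta>))"
proof
  assume dm: "difference_monotone (\<lambda>x :: real ^ 'n::{finite, linorder}. E2 x powr (- \<beta>))"
  \<comment> \<open>With this \<open>m\<close>, \<open>2 * \<beta>\<close> is at least
    \<open>m - 3\<close> and less than \<open>m - 2\<close>, so both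
    \<open>real m - 2 - 2 * \<beta>\<close> and \<open>2 * \<beta> + 4 - real m\<close> are
    positive. The upper bound on \<open>\<beta>\<close> leaves room for \<open>m\<close>
    variables.\<close>
  define m where "m = nat \<lfloor>2 * \<beta>\<rfloor> + 3"
  have m: "real m - 3 \<le> 2 * \<beta>" "2 * \<beta> < real m - 2" "3 \<le> m"
    using \<beta>(1) by (auto simp: m_def) linarith+
  have "m \<le> CARD('n)"
  proof -
    have "\<lfloor>2 * \<beta>\<rfloor> < int CARD('n) - 2"
      using \<beta>(2) by (simp add: floor_less_iff)
    moreover have "0 \<le> \<lfloor>2 * \<beta>\<rfloor>" using \<beta>(1) by simp
    ultimately show ?thesis unfolding m_def by linarith
  qed
  then obtain J :: "'n set" where J: "card J = m"
    by (rule obtain_subset_with_card_n)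
  define k where "k = real (card (- J))"
  \<comment> \<open>\<open>E \<epsilon>\<close> and \<open>\<rho> \<epsilon>\<close> are the values
    of \<open>E2\<close> and \<open>outer_part J\<close> at the point with coordinates
    \<open>1\<close> on \<open>J\<close> and \<open>\<epsilon>\<close> elsewhere. In the limit the
    outer part disappears while \<open>E 0\<close> stays positive.\<close>
  define E where "E \<epsilon> = ((real m + k * \<epsilon>)\<^sup>2 - (real m + k * \<epsilon>\<^sup>2)) / 2" for \<epsilon>
  define \<rho> where "\<rho> \<epsilon> = (k * \<epsilon>)\<^sup>2 / (real m - 1) + k * \<epsilon>\<^sup>2" for \<epsilon>
  define \<gamma> where "\<gamma> = - \<beta>"
  define F where "F \<epsilon> = \<gamma> * (2 * \<gamma> - 2 + real m) *
      ((\<gamma> - 1) * (2 * \<gamma> - 4 + real m) * E \<epsilon> powr (\<gamma> - 2) +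
       (\<gamma> - 1) * (\<gamma> - 2) * (\<rho> \<epsilon> * E \<epsilon> powr (\<gamma> - 3))) +
    \<gamma> * (\<gamma> - 1) * (\<rho> \<epsilon> *
      ((\<gamma> - 2) * (2 * \<gamma> - 6 + real m) * E \<epsilon> powr (\<gamma> - 3) +
       (\<gamma> - 2) * (\<gamma> - 3) * (\<rho> \<epsilon> * E \<epsilon> powr (\<gamma> - 4))))" for \<epsilon>
  have "0 \<le> F \<epsilon>" if "0 < \<epsilon>" for \<epsilon>
  proof -
    define x :: "real ^ 'n::{finite, linorder}" where "x = (\<chi> i. if i \<in> J then 1 else \<epsilon>)"
    have x: "x \<in> positive_orthant" using that by (simp add: x_def positive_orthant_def)
    have split: "(\<Sum>i\<in>UNIV. f i) = (\<Sum>i\<in>J. f i) + (\<Sum>i\<in>- J. f i)" for f :: "'n \<Rightarrow> real"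
      by (subst sum.union_disjoint[symmetric]) auto
    have "E2 x = E \<epsilon>"
      unfolding E2_eq split E_def by (simp add: x_def k_def J)
    moreover have "outer_part J x = \<rho> \<epsilon>"
      unfolding outer_part_def \<rho>_def by (simp add: x_def k_def J)
    moreover have "2 \<le> card J" using J m by simp
    ultimately show ?thesis
      using quadratic_partial_square_nonneg[OF dm C_infinity_on_E2_powr[OF n] x, of "dual_form J"]
      by (simp only: E2_powr_dual_form_square[OF n x] J F_def \<gamma>_def)
  qed
  then have nonneg: "\<forall>\<^sub>F \<epsilon> in at_right 0. 0 \<le> F \<epsilon>"
    using eventually_at_right_less[of 0] by (auto elim: eventually_mono)
  have E0: "0 < E 0" using m by (simp add: E_def power2_eq_square)
  have E: "(E \<longlongrightarrow> E 0) (at_right 0)"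
    unfolding E_def by (intro tendsto_intros) auto
  have "(\<rho> \<longlongrightarrow> \<rho> 0) (at_right 0)"
    unfolding \<rho>_def using m by (intro tendsto_intros) auto
  then have \<rho>: "(\<rho> \<longlongrightarrow> 0) (at_right 0)" by (simp add: \<rho>_def)
  define L where "L = \<gamma> * (2 * \<gamma> - 2 + real m) * ((\<gamma> - 1) * (2 * \<gamma> - 4 + real m) * E 0 powr (\<gamma> - 2))"
  have "(F \<longlongrightarrow> \<gamma> * (2 * \<gamma> - 2 + real m) *
      ((\<gamma> - 1) * (2 * \<gamma> - 4 + real m) * E 0 powr (\<gamma> - 2) +
       (\<gamma> - 1) * (\<gamma> - 2) * (0 * E 0 powr (\<gamma> - 3))) +
    \<gamma> * (\<gamma> - 1) * (0 *
      ((\<gamma> - 2) * (2 * \<gamma> - 6 + real m) * E 0 powr (\<gamma> - 3) +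
       (\<gamma> - 2) * (\<gamma> - 3) * (0 * E 0 powr (\<gamma> - 4))))) (at_right 0)"
    unfolding F_def using E0 by (intro tendsto_intros E \<rho>) auto
  then have "(F \<longlongrightarrow> L) (at_right 0)" by (simp add: L_def)
  then have "0 \<le> L"
    using nonneg by (rule tendsto_lowerbound) simp
  moreover have "L = - (\<beta> * (\<beta> + 1) * (real m - 2 - 2 * \<beta>) * (2 * \<beta> + 4 - real m) * E 0 powr (\<gamma> - 2))"
    by (simp add: L_def \<gamma>_def algebra_simps)
  moreover have "0 < \<beta> * (\<beta> + 1) * (real m - 2 - 2 * \<beta>) * (2 * \<beta> + 4 - real m) * E 0 powr (\<gamma> - 2)"
    using \<beta> m E0 by (intro mult_pos_pos) auto
  ultimately show False by linarith
qed

theorem corollary1p10: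
  fixes \<beta> :: real
  assumes "CARD('n::{finite, linorder}) \<ge> 2"
  shows "completely_monotone (\<lambda>x :: real ^ 'n::{finite, linorder}. E2 x powr (- \<beta>)) \<longleftrightarrow>
           \<beta> = 0 \<or> \<beta> \<ge> (real CARD('n::{finite, linorder}) - 2) / 2"
proof
  assume "completely_monotone (\<lambda>x :: real ^ 'n::{finite, linorder}. E2 x powr (- \<beta>))"
  then have dm: "difference_monotone (\<lambda>x :: real ^ 'n::{finite, linorder}. E2 x powr (- \<beta>))"
    by (rule completely_monotone_imp_difference_monotone)
  then show "\<beta> = 0 \<or> \<beta> \<ge> (real CARD('n::{finite, linorder}) - 2) / 2"
    using not_difference_monotone_E2_powr_pos[OF assms, of "- \<beta>"]
      not_difference_monotone_E2_powr_neg[OF assms, of \<beta>]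
    by (cases "\<beta>" "0 :: real" rule: linorder_cases) force+
next
  assume \<beta>: "\<beta> = 0 \<or> \<beta> \<ge> (real CARD('n::{finite, linorder}) - 2) / 2"
  have "difference_monotone (\<lambda>x :: real ^ 'n::{finite, linorder}. E2 x powr (- \<beta>))"
  proof (cases "\<beta> = 0")
    case True
    have "difference_monotone (\<lambda>x :: real ^ 'n::{finite, linorder}. 1 :: real)"
      by (rule difference_monotone_const) simp
    then show ?thesis
      by (rule difference_monotone_cong) (use True E2_pos[OF assms] in force)
  next
    case False
    with \<beta> assms have "0 < \<beta>" by auto
    with \<beta> False show ?thesis by (intro difference_monotone_E2_powr assms) auto
  qed
  then show "completely_monotone (\<lambda>x :: real ^ 'n::{finite, linorder}. E2 x powr (- \<beta>))"
    by (intro completely_monotoneI C_infinity_on_E2_powr assms)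
qed

end
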